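(* Let $\mathcal{E}$ be a system of evolution equations $u_t=f(x,t,u,u_1,\dots,u_k)$, and let $\mathcal{H}_A$ and $\mathcal{H}_B$ be shadows of symmetries in the $\ell^*$-covering $\mathcal{L}^*\mathcal{E}$ corresponding to skew-adjoint $\mathcal{C}$-differential operators $A,B\colon\hat\varkappa\to\varkappa$. Then $$\{\mathcal{H}_A,\mathcal{H}_B\}=\mathcal{H}_{[\![A,B]\!]},$$ where $\{\cdot,\cdot\}$ is the Jacobi bracket on $\mathcal{L}^*\mathcal{E}$ and $[\![A,B]\!]$ is the variational Schouten bracket.
   Context: Setting: $u=(u^1,\dots,u^m)$, one space variable $x$. $\mathcal{E}$ has coordinates $x,t,u^j_k$ and total derivatives $D_x=\partial_x+\sum_{j,k}u^j_{k+1}\partial_{u^j_k}$, $D_t=\partial_t+\sum_{j,k}D_x^k(f^j)\partial_{u^j_k}$; $\mathcal{F}(\mathcal{E})$ is the algebra of smooth functions in $x,t$ and finitely many $u^j_k$. $\varkappa$ and $\hat\varkappa=\mathrm{Hom}_{\mathcal{F}(\mathcal{E})}(\varkappa,\mathcal{F}(\mathcal{E})dx)$ are, in coordinates, modules of $m$-tuples of functions from $\mathcal{F}(\mathcal{E})$ (variational vectors, resp. 1-forms). $\mathcal{C}$-differential operators are matrices with entries $\sum_i a_iD_x^i$, $a_i\in\mathcal{F}(\mathcal{E})$; $*$ is the formal adjoint; $A$ is skew-adjoint if $A^*=-A$. $\mathcal{E}_\varphi=\sum_{j,k}D_x^k(\varphi^j)\partial_{u^j_k}$; $\ell_\psi(\varphi)=\mathcal{E}_\varphi(\psi)$;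 $\ell_{\Delta,\psi}(\varphi)=\mathcal{E}_\varphi(\Delta)(\psi)$ ($\mathcal{E}_\varphi$ acting on the coefficients of $\Delta$), with adjoint $\ell^*_{\Delta,\psi}$ in $\varphi$. The equation has linearization $\ell_{\mathcal{E}}=D_t-\ell_f$. Schouten bracket: $[\![A,B]\!](\psi_1,\psi_2)=-\ell_{A,\psi_1}(B\psi_2)+\ell_{A,\psi_2}(B\psi_1)-A(\ell^*_{B,\psi_1}(\psi_2))-\ell_{B,\psi_1}(A\psi_2)+\ell_{B,\psi_2}(A\psi_1)-B(\ell^*_{A,\psi_1}(\psi_2))$, a skew-symmetric bilinear $\mathcal{C}$-differential operator. $\ell^*$-covering $\mathcal{L}^*\mathcal{E}$: add odd (anticommuting) variables $p^j_k$, $1\le j\le m$, $k\ge0$ ($p^j=p^j_0$), subject to $p_t=-\ell_f^*(p)$; total derivatives $\tilde D_x=D_x+\sum p^j_{k+1}\partial_{p^j_k}$, $\tilde D_t=D_t-\sum\tilde D_x^k(\tilde\ell_f^*(p)^j)\partial_{p^j_k}$. A tilde over a $\mathcal{C}$-differential operator means that $D_x,D_t$ are replaced by $\tilde D_x,\tilde D_t$. Functions on $\mathcal{L}^*\mathcal{E}$ are polynomials in the $p^j_k$ over $\mathcal{F}(\mathcal{E})$. For $A=\|\sum_i a^l_{ij}D_x^i\|$ put $\mathcal{H}_A^l=\sum_{i,j}a^l_{ij}p^j_i$. $\mathcal{H}_A$ is a shadow of symmetry if $\tilde\ell_{\mathcal{E}}(\mathcal{H}_A)=0$. For an $m$-vector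 function $\mathcal{H}$ on $\mathcal{L}^*\mathcal{E}$: $\tilde\ell_{\mathcal{H}}(\chi)^l=\sum\frac{\partial\mathcal{H}^l}{\partial u^j_k}\tilde D_x^k(\chi^j)$ and $\tilde\ell^*_{\mathcal{H}}(p)^j=\sum_{k,l}(-1)^k\tilde D_x^k\bigl(\frac{\partial\mathcal{H}^l}{\partial u^j_k}p^l\bigr)$ (factors in the order written). Put $\alpha_A=-\tfrac12\tilde\ell^*_{\mathcal{H}_A}(p)$ and let $Q_A=\sum_{k,j}\tilde D_x^k(\mathcal{H}_A^j)\partial_{u^j_k}+\sum_{k,j}\tilde D_x^k(\alpha_A^j)\partial_{p^j_k}$ (an odd derivation). The Jacobi bracket is $\{\mathcal{H}_A,\mathcal{H}_B\}=Q_A(\mathcal{H}_B)+Q_B(\mathcal{H}_A)$; explicitly $$\{\mathcal{H}_A,\mathcal{H}_B\}=-\tilde\ell_{\mathcal{H}_A}(\mathcal{H}_B)-\tilde\ell_{\mathcal{H}_B}(\mathcal{H}_A)-\tfrac12\bigl(A(\tilde\ell^*_{\mathcal{H}_B}(p))+B(\tilde\ell^*_{\mathcal{H}_A}(p))\bigr),$$ with $A,B$ lifted to $\mathcal{L}^*\mathcal{E}$. Correspondence for bilinear operators: skew-symmetric bilinear $\mathcal{C}$-differential operators $\Delta\colon\hat\varkappa\times\hat\varkappa\to\varkappa$ correspond bijectively to vector functions $\mathcal{H}_\Delta$ quadratic in the odd variables, the monomial $c\,p^a_ip^b_j$ corresponding to the operator $(\psi_1,\psi_2)\mapsto c\,\bigl(D_x^i(\psi_1^a)D_x^j(\psi_2^b)-D_x^j(\psi_1^b)D_x^i(\psi_2^a)\bigr)$;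 equivalently, if $\Delta(\psi_1,\psi_2)=\sum c^{ij}_{ab}D_x^i(\psi_1^a)D_x^j(\psi_2^b)$ is skew-symmetric, then $\mathcal{H}_\Delta=\tfrac12\sum c^{ij}_{ab}p^a_ip^b_j$. *)

theory Defs
  imports "HOL-Analysis.Analysis" "HOL-Library.Groups_Big_Fun"
begin

section \<open>Differential functions\<close>

text \<open>The dependent variables are indexed by a finite type \<open>'m\<close>. A point of the equation assigns a
  real number to each of the coordinates \<open>x\<close>, \<open>t\<close>, \<open>u\<^sup>j\<^sub>k\<close>.\<close>

datatype 'm coord = X | T | U 'm nat

type_synonym 'm point = "'m coord \<Rightarrow> real"

definition pd :: "'m coord \<Rightarrow> ('m point \<Rightarrow> real) \<Rightarrow> 'm point \<Rightarrow> real" where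
  "pd c F z = deriv (\<lambda>s. F (z(c := s))) (z c)"

text \<open>Continuity refers to the product topology; for a function of finitely many coordinates
  this is ordinary continuity in these coordinates.\<close>

primrec Ck :: "nat \<Rightarrow> ('m point \<Rightarrow> real) \<Rightarrow> bool" where
  "Ck 0 F \<longleftrightarrow> continuous_on UNIV F"
| "Ck (Suc n) F \<longleftrightarrow> continuous_on UNIV F
     \<and> (\<forall>c z. (\<lambda>s. F (z(c := s))) field_differentiable at (z c)) \<and> (\<forall>c. Ck n (pd c F))"

definition finitary :: "('m point \<Rightarrow> real) \<Rightarrow> bool" where
  "finitary F \<longleftrightarrow> (\<exists>C. finite C \<and> (\<forall>z z'. (\<forall>c\<in>C. z c = z' c) \<longrightarrow> F z = F z'))"

definition diff_function :: "('m point \<Rightarrow> real) \<Rightarrow> bool" where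
  "diff_function F \<longleftrightarrow> finitary F \<and> (\<forall>n. Ck n F)"

lemma Ck_continuous: "Ck n F \<Longrightarrow> continuous_on UNIV F"
  by (cases n) auto

lemma Ck_Suc_D: "Ck (Suc n) F \<Longrightarrow> Ck n F"
  by (induction n arbitrary: F) auto

lemma pd_const: "pd c (\<lambda>_. a) = (\<lambda>_. 0)"
  by (simp add: pd_def fun_eq_iff)

lemma Ck_const: "Ck n (\<lambda>_. a)"
  by (induction n arbitrary: a) (auto simp: pd_const)

lemma pd_coord: "pd c (\<lambda>z. z d) = (\<lambda>_. if c = d then 1 else 0)"
  by (auto simp: pd_def fun_eq_iff)

lemma Ck_coord: "Ck n (\<lambda>z. z d)"
proof (cases n)
  case 0
  then show ?thesis by (simp add: continuous_on_product_coordinates)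
next
  case (Suc m)
  have "(\<lambda>s. (z(c := s)) d) field_differentiable at (z c)" for c :: "'a coord" and z :: "'a point"
    by (cases "c = d") auto
  then show ?thesis
    by (simp add: Suc continuous_on_product_coordinates pd_coord Ck_const)
qed

lemma Ck_add: "Ck n F \<Longrightarrow> Ck n G \<Longrightarrow> Ck n (\<lambda>z. F z + G z)"
proof (induction n arbitrary: F G)
  case 0
  then show ?case by (auto intro: continuous_intros)
next
  case (Suc n)
  have "pd c (\<lambda>z. F z + G z) = (\<lambda>z. pd c F z + pd c G z)" for c
    using Suc.prems by (auto simp: pd_def fun_eq_iff)
  with Suc show ?case
    by (simp add: continuous_on_add field_differentiable_add)
qed

lemma Ck_mult: "Ck n F \<Longrightarrow> Ck n G \<Longrightarrow> Ck n (\<lambda>z. F z * G z)"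
proof (induction n arbitrary: F G)
  case 0
  then show ?case by (auto intro: continuous_intros)
next
  case (Suc n)
  have "pd c (\<lambda>z. F z * G z) = (\<lambda>z. F z * pd c G z + pd c F z * G z)" for c
    using Suc.prems by (auto simp: pd_def fun_eq_iff)
  moreover have "Ck n (\<lambda>z. F z * pd c G z + pd c F z * G z)" for c
  proof (intro Ck_add Suc.IH)
    show "Ck n F" "Ck n G" using Suc.prems by (blast intro: Ck_Suc_D)+
  qed (use Suc.prems in auto)
  ultimately show ?case
    using Suc.prems by (simp add: continuous_on_mult field_differentiable_mult)
qed

lemma finitary_const: "finitary (\<lambda>_. a)"
  by (auto simp: finitary_def)

lemma finitary_coord: "finitary (\<lambda>z. z d)"
  unfolding finitary_def by (rule exI[of _ "{d}"]) auto

lemma finitary_binop: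
  assumes "finitary F" "finitary G"
  shows "finitary (\<lambda>z. h (F z) (G z))"
proof -
  obtain C D where "finite C" "finite D"
    "\<And>z z'. (\<forall>c\<in>C. z c = z' c) \<Longrightarrow> F z = F z'" "\<And>z z'. (\<forall>c\<in>D. z c = z' c) \<Longrightarrow> G z = G z'"
    using assms unfolding finitary_def by metis
  then show ?thesis
    unfolding finitary_def by (intro exI[of _ "C \<union> D"]) (metis UnCI finite_Un)
qed

lemma pd_eq_0_outside:
  assumes "\<And>z z'. (\<forall>c\<in>C. z c = z' c) \<Longrightarrow> F z = F z'" "c \<notin> C"
  shows "pd c F = (\<lambda>_. 0)"
proof
  fix z
  have "(\<lambda>s. F (z(c := s))) = (\<lambda>_. F z)"
    using assms by (metis fun_upd_apply)
  then show "pd c F z = 0" by (simp add: pd_def)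
qed

lemma finitary_pd:
  assumes "finitary F"
  shows "finitary (pd c F)"
proof -
  obtain C where C: "finite C" "\<And>z z'. (\<forall>c\<in>C. z c = z' c) \<Longrightarrow> F z = F z'"
    using assms unfolding finitary_def by metis
  have "pd c F z = pd c F z'" if "\<forall>c\<in>C. z c = z' c" for z z'
  proof (cases "c \<in> C")
    case True
    have "(\<lambda>s. F (z(c := s))) = (\<lambda>s. F (z'(c := s)))"
      using that by (intro ext C(2)) auto
    then show ?thesis using True that by (simp add: pd_def)
  next
    case False
    then show ?thesis using pd_eq_0_outside[of C F c] C(2) by simp
  qed
  with C(1) show ?thesis unfolding finitary_def by blast
qed

typedef 'm jfun = "{F :: 'm point \<Rightarrow> real. diff_function F}"
  morphisms jval Abs_jfun
  by (rule exI[of _ "\<lambda>_. 0"]) (simp add: diff_function_def finitary_const Ck_const)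

setup_lifting type_definition_jfun

instantiation jfun :: (type) "{comm_ring_1, real_algebra_1}"
begin

lift_definition zero_jfun :: "'a jfun" is "\<lambda>_. 0"
  by (simp add: diff_function_def finitary_const Ck_const)

lift_definition one_jfun :: "'a jfun" is "\<lambda>_. 1"
  by (simp add: diff_function_def finitary_const Ck_const)

lift_definition plus_jfun :: "'a jfun \<Rightarrow> 'a jfun \<Rightarrow> 'a jfun" is "\<lambda>F G z. F z + G z"
  by (simp add: diff_function_def finitary_binop Ck_add)

lift_definition times_jfun :: "'a jfun \<Rightarrow> 'a jfun \<Rightarrow> 'a jfun" is "\<lambda>F G z. F z * G z"
  by (simp add: diff_function_def finitary_binop Ck_mult)

lift_definition scaleR_jfun :: "real \<Rightarrow> 'a jfun \<Rightarrow> 'a jfun" is "\<lambda>r F z. r * F z"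
  by (auto simp: diff_function_def intro!: Ck_mult Ck_const
        finitary_binop[where h = "\<lambda>a b. _ * b", OF finitary_const])

definition uminus_jfun :: "'a jfun \<Rightarrow> 'a jfun" where
  "uminus_jfun F = (-1) *\<^sub>R F"

definition minus_jfun :: "'a jfun \<Rightarrow> 'a jfun \<Rightarrow> 'a jfun" where
  "minus_jfun F G = F + (-1) *\<^sub>R G"

instance
proof
  fix a b c :: "'a jfun" and r s :: real
  show "a + b + c = a + (b + c)" "a + b = b + a" "0 + a = a"
    "r *\<^sub>R (a + b) = r *\<^sub>R a + r *\<^sub>R b" "(r + s) *\<^sub>R a = r *\<^sub>R a + s *\<^sub>R a"
    "r *\<^sub>R s *\<^sub>R a = (r * s) *\<^sub>R a" "1 *\<^sub>R a = a"
    "a * b * c = a * (b * c)" "a * b = b * a" "1 * a = a" "a * 1 = a"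
    "(a + b) * c = a * c + b * c" "a * (b + c) = a * b + a * c"
    "r *\<^sub>R a * b = r *\<^sub>R (a * b)" "a * r *\<^sub>R b = r *\<^sub>R (a * b)"
    by (transfer; simp add: fun_eq_iff algebra_simps)+
  show "- a + a = 0" "a - b = a + - b"
    unfolding uminus_jfun_def minus_jfun_def by (transfer; simp add: fun_eq_iff)+
  show "(0 :: 'a jfun) \<noteq> 1"
    by transfer (simp add: fun_eq_iff)
qed

end

lift_definition coord_fun :: "'m coord \<Rightarrow> 'm jfun" is "\<lambda>c z. z c"
  by (simp add: diff_function_def finitary_coord Ck_coord)

lift_definition jpd :: "'m coord \<Rightarrow> 'm jfun \<Rightarrow> 'm jfun" is pd
proof -
  fix c :: "'m coord" and F :: "'m point \<Rightarrow> real"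
  assume "diff_function F"
  then have "finitary F" "\<And>n. Ck (Suc n) F" by (simp_all only: diff_function_def)
  then show "diff_function (pd c F)" by (simp add: diff_function_def finitary_pd)
qed

lemma finite_jpd: "finite {c. jpd c F \<noteq> 0}"
proof transfer
  fix F :: "'m point \<Rightarrow> real"
  assume "diff_function F"
  then obtain C where C: "finite C" "\<And>z z'. (\<forall>c\<in>C. z c = z' c) \<Longrightarrow> F z = F z'"
    unfolding diff_function_def finitary_def by metis
  have "{c. pd c F \<noteq> (\<lambda>_. 0)} \<subseteq> C"
    using pd_eq_0_outside[of C F] C(2) by blast
  then show "finite {c. pd c F \<noteq> (\<lambda>_. 0)}" using C(1) by (rule finite_subset)
qed


section \<open>Evolution equations and \<open>\<C>\<close>-differential operators\<close>

text \<open>\<^const>\<open>Sum_any\<close> sums over all indices with a nonzero summand. For a finite index type \<open>'m\<close> and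
  operators of finite order, there are finitely many of these in all sums below.\<close>

definition Dx :: "'m jfun \<Rightarrow> 'm jfun" where
  "Dx F = jpd X F + Sum_any (\<lambda>(j, k). coord_fun (U j (Suc k)) * jpd (U j k) F)"

definition evol :: "('m \<Rightarrow> 'm jfun) \<Rightarrow> 'm jfun \<Rightarrow> 'm jfun" where
  "evol \<phi> F = Sum_any (\<lambda>(j, k). (Dx ^^ k) (\<phi> j) * jpd (U j k) F)"

definition Dt :: "('m \<Rightarrow> 'm jfun) \<Rightarrow> 'm jfun \<Rightarrow> 'm jfun" where
  "Dt f F = jpd T F + Sum_any (\<lambda>(j, k). (Dx ^^ k) (f j) * jpd (U j k) F)"

text \<open>The value \<open>A l i j\<close> is the coefficient of \<open>D\<^sub>x\<^sup>i\<close> in the entry \<open>(l, j)\<close> of the matrix operator.\<close>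

type_synonym 'm operator = "'m \<Rightarrow> nat \<Rightarrow> 'm \<Rightarrow> 'm jfun"

definition cdiff_operator :: "'m operator \<Rightarrow> bool" where
  "cdiff_operator A \<longleftrightarrow> finite {(l, i, j). A l i j \<noteq> 0}"

definition op_app :: "'m operator \<Rightarrow> ('m \<Rightarrow> 'm jfun) \<Rightarrow> 'm \<Rightarrow> 'm jfun" where
  "op_app A \<psi> l = Sum_any (\<lambda>(i, j). A l i j * (Dx ^^ i) (\<psi> j))"

definition adj_app :: "'m operator \<Rightarrow> ('m \<Rightarrow> 'm jfun) \<Rightarrow> 'm \<Rightarrow> 'm jfun" where
  "adj_app A \<psi> j = Sum_any (\<lambda>(i, l). (-1) ^ i * (Dx ^^ i) (A l i j * \<psi> l))"

definition skew_adjoint :: "'m operator \<Rightarrow> bool" where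
  "skew_adjoint A \<longleftrightarrow> (\<forall>\<psi> l. adj_app A \<psi> l = - op_app A \<psi> l)"

text \<open>\<open>op_lin A \<psi>\<close> is the operator \<open>\<phi> \<mapsto> \<ell>\<^bsub>A,\<psi>\<^esub>(\<phi>)\<close> in matrix form; see lemma \<open>op_app_op_lin\<close>.\<close>

definition ell :: "'m operator \<Rightarrow> ('m \<Rightarrow> 'm jfun) \<Rightarrow> ('m \<Rightarrow> 'm jfun) \<Rightarrow> 'm \<Rightarrow> 'm jfun" where
  "ell A \<psi> \<phi> = op_app (\<lambda>l i j. evol \<phi> (A l i j)) \<psi>"

definition op_lin :: "'m operator \<Rightarrow> ('m \<Rightarrow> 'm jfun) \<Rightarrow> 'm operator" where
  "op_lin A \<psi> l k s = Sum_any (\<lambda>(i, j). jpd (U s k) (A l i j) * (Dx ^^ i) (\<psi> j))"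

definition ell_adj :: "'m operator \<Rightarrow> ('m \<Rightarrow> 'm jfun) \<Rightarrow> ('m \<Rightarrow> 'm jfun) \<Rightarrow> 'm \<Rightarrow> 'm jfun" where
  "ell_adj A \<psi> = adj_app (op_lin A \<psi>)"

definition schouten ::
  "'m operator \<Rightarrow> 'm operator \<Rightarrow> ('m \<Rightarrow> 'm jfun) \<Rightarrow> ('m \<Rightarrow> 'm jfun) \<Rightarrow> 'm \<Rightarrow> 'm jfun" where
  "schouten A B \<psi>1 \<psi>2 l =
     - ell A \<psi>1 (op_app B \<psi>2) l + ell A \<psi>2 (op_app B \<psi>1) l - op_app A (ell_adj B \<psi>1 \<psi>2) l
     - ell B \<psi>1 (op_app A \<psi>2) l + ell B \<psi>2 (op_app A \<psi>1) l - op_app B (ell_adj A \<psi>1 \<psi>2) l"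

lemma jpd_0 [simp]: "jpd c 0 = 0"
  by transfer (simp add: pd_const)

lemma finite_jpd_U: "finite {(j, k). jpd (U j k) F \<noteq> 0}"
proof -
  have "(\<lambda>(j, k). U j k) ` {(j, k). jpd (U j k) F \<noteq> 0} \<subseteq> {c. jpd c F \<noteq> 0}" by auto
  moreover have "inj_on (\<lambda>(j, k). U j k) {(j, k). jpd (U j k) F \<noteq> 0}" by (auto simp: inj_on_def)
  ultimately show ?thesis using finite_jpd inj_on_finite by blast
qed

lemma op_app_op_lin:
  fixes A :: "'m operator"
  assumes "cdiff_operator A"
  shows "op_app (op_lin A \<psi>) \<phi> = ell A \<psi> \<phi>"
proof
  fix l
  define P where "P = {(i, j). A l i j \<noteq> 0}"
  define Q where "Q = (\<Union>(i, j)\<in>P. {(k, s). jpd (U s k) (A l i j) \<noteq> 0})"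
  have "P \<subseteq> snd ` {(l, i, j). A l i j \<noteq> 0}" unfolding P_def by force
  then have fP: "finite P" using assms unfolding cdiff_operator_def by (meson finite_surj)
  have "finite {(k, s). jpd (U s k) F \<noteq> 0}" for F :: "'m jfun"
  proof -
    have "{(k, s). jpd (U s k) F \<noteq> 0} = prod.swap ` {(j, k). jpd (U j k) F \<noteq> 0}" by force
    then show ?thesis using finite_jpd_U[of F] by simp
  qed
  then have fQ: "finite Q" unfolding Q_def using fP by auto
  have lin: "op_lin A \<psi> l k s = (\<Sum>(i, j)\<in>P. jpd (U s k) (A l i j) * (Dx ^^ i) (\<psi> j))" for k s
    unfolding op_lin_def by (rule Sum_any.expand_superset) (use fP in \<open>auto simp: P_def\<close>)
  have out: "jpd (U s k) (A l i j) = 0" if "(k, s) \<notin> Q" for i j k s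
    using that unfolding Q_def P_def by (cases "A l i j = 0") auto
  have lin_out: "op_lin A \<psi> l k s = 0" if "(k, s) \<notin> Q" for k s
    unfolding lin by (rule sum.neutral) (simp add: out[OF that] case_prod_beta')
  have ev: "evol \<phi> (A l i j) = (\<Sum>(k, s)\<in>Q. (Dx ^^ k) (\<phi> s) * jpd (U s k) (A l i j))" for i j
  proof -
    have "evol \<phi> (A l i j) = (\<Sum>(s, k)\<in>prod.swap ` Q. (Dx ^^ k) (\<phi> s) * jpd (U s k) (A l i j))"
      unfolding evol_def
    proof (rule Sum_any.expand_superset)
      show "{a. (case a of (s, k) \<Rightarrow> (Dx ^^ k) (\<phi> s) * jpd (U s k) (A l i j)) \<noteq> 0}
        \<subseteq> prod.swap ` Q"
      proof
        fix a
        assume "a \<in> {a. (case a of (s, k) \<Rightarrow> (Dx ^^ k) (\<phi> s) * jpd (U s k) (A l i j)) \<noteq> 0}"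
        then obtain s k where "a = (s, k)" "jpd (U s k) (A l i j) \<noteq> 0"
          by (cases a) (auto dest!: mult_not_zero)
        then have "a = prod.swap (k, s)" "(k, s) \<in> Q" using out by auto
        then show "a \<in> prod.swap ` Q" by blast
      qed
    qed (use fQ in simp)
    then show ?thesis by (simp add: sum.reindex case_prod_beta')
  qed
  have "op_app (op_lin A \<psi>) \<phi> l = (\<Sum>(k, s)\<in>Q. op_lin A \<psi> l k s * (Dx ^^ k) (\<phi> s))"
    unfolding op_app_def
  proof (rule Sum_any.expand_superset[OF fQ], rule subsetI)
    fix a assume "a \<in> {a. (case a of (k, s) \<Rightarrow> op_lin A \<psi> l k s * (Dx ^^ k) (\<phi> s)) \<noteq> 0}"
    then obtain k s where "a = (k, s)" "op_lin A \<psi> l k s \<noteq> 0"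
      by (cases a) (auto dest!: mult_not_zero)
    then show "a \<in> Q" using lin_out by blast
  qed
  also have "\<dots> = (\<Sum>(k, s)\<in>Q. \<Sum>(i, j)\<in>P.
      (Dx ^^ k) (\<phi> s) * jpd (U s k) (A l i j) * (Dx ^^ i) (\<psi> j))"
    by (simp add: lin sum_distrib_left case_prod_beta' mult_ac)
  also have "\<dots> = (\<Sum>(i, j)\<in>P. \<Sum>(k, s)\<in>Q.
      (Dx ^^ k) (\<phi> s) * jpd (U s k) (A l i j) * (Dx ^^ i) (\<psi> j))"
    unfolding case_prod_beta' by (rule sum.swap)
  also have "\<dots> = (\<Sum>(i, j)\<in>P. evol \<phi> (A l i j) * (Dx ^^ i) (\<psi> j))"
    by (simp add: ev sum_distrib_right case_prod_beta')
  also have "\<dots> = ell A \<psi> \<phi> l"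
    unfolding ell_def op_app_def
  proof (rule Sum_any.expand_superset[OF fP, symmetric], rule subsetI)
    fix a assume "a \<in> {a. (case a of (i, j) \<Rightarrow> evol \<phi> (A l i j) * (Dx ^^ i) (\<psi> j)) \<noteq> 0}"
    then obtain i j where "a = (i, j)" "evol \<phi> (A l i j) \<noteq> 0"
      by (cases a) (auto dest!: mult_not_zero)
    moreover have "evol \<phi> 0 = 0" by (simp add: evol_def case_prod_beta')
    ultimately show "a \<in> P" by (auto simp: P_def)
  qed
  finally show "op_app (op_lin A \<psi>) \<phi> l = ell A \<psi> \<phi> l" .
qed


type_synonym 'm gen = "'m \<times> nat"

text \<open>Bilinear operators: the value \<open>c l (a, i) (b, j)\<close> is the coefficient of \<open>D\<^sub>x\<^sup>i(\<psi>\<^sub>1\<^sup>a) D\<^sub>x\<^sup>j(\<psi>\<^sub>2\<^sup>b)\<close> in the component \<open>l\<close>.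
  The coefficients are determined by the operator; see lemma \<open>bi_app_inject\<close>.\<close>

type_synonym 'm bicoeffs = "'m \<Rightarrow> 'm gen \<Rightarrow> 'm gen \<Rightarrow> 'm jfun"

definition bi_finite :: "'m bicoeffs \<Rightarrow> bool" where
  "bi_finite c \<longleftrightarrow> finite {(l, g, h). c l g h \<noteq> 0}"

definition bi_app ::
  "'m bicoeffs \<Rightarrow> ('m \<Rightarrow> 'm jfun) \<Rightarrow> ('m \<Rightarrow> 'm jfun) \<Rightarrow> 'm \<Rightarrow> 'm jfun" where
  "bi_app c \<psi>1 \<psi>2 l =
     Sum_any (\<lambda>((a, i), (b, j)). c l (a, i) (b, j) * (Dx ^^ i) (\<psi>1 a) * (Dx ^^ j) (\<psi>2 b))"

lemma jpd_mult: "jpd c (F * G) = F * jpd c G + jpd c F * G"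
proof transfer
  fix c :: "'a coord" and F G :: "'a point \<Rightarrow> real"
  assume "diff_function F" "diff_function G"
  then have "Ck (Suc 0) F" "Ck (Suc 0) G" by (simp_all only: diff_function_def)
  then show "pd c (\<lambda>z. F z * G z) = (\<lambda>z. F z * pd c G z + pd c F z * G z)"
    by (auto simp: pd_def fun_eq_iff)
qed

lemma jpd_add: "jpd c (F + G) = jpd c F + jpd c G"
proof transfer
  fix c :: "'a coord" and F G :: "'a point \<Rightarrow> real"
  assume "diff_function F" "diff_function G"
  then have "Ck (Suc 0) F" "Ck (Suc 0) G" by (simp_all only: diff_function_def)
  then show "pd c (\<lambda>z. F z + G z) = (\<lambda>z. pd c F z + pd c G z)"
    by (auto simp: pd_def fun_eq_iff)
qed

lemma jpd_const [simp]: "jpd c (r *\<^sub>R 1) = 0"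
  by transfer (simp add: pd_const)

lemma jpd_scaleR: "jpd c (r *\<^sub>R F) = r *\<^sub>R jpd c F"
  using jpd_mult[of c "r *\<^sub>R 1" F] by simp

lemma jpd_coord_fun: "jpd c (coord_fun d) = (if c = d then 1 else 0)"
  by transfer (auto simp: pd_coord)

text \<open>Test functions \<open>(x - x\<^sub>0)\<^sup>n / n!\<close>, used to recover the coefficients of an operator.\<close>

definition taylor :: "real \<Rightarrow> nat \<Rightarrow> 'm jfun" where
  "taylor x0 n = (1 / fact n) *\<^sub>R (coord_fun X + (- x0) *\<^sub>R 1) ^ n"

lemma jpd_taylor:
  "jpd c (taylor x0 n) = (if c = X \<and> n > 0 then taylor x0 (n - 1) else 0)"
proof -
  define s :: "'a jfun" where "s = coord_fun X + (- x0) *\<^sub>R 1"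
  have s: "jpd c s = (if c = X then 1 else 0)"
    unfolding s_def by (simp only: jpd_add jpd_const jpd_coord_fun add_0_right)
  have pow: "jpd c (s ^ Suc n) = (if c = X then real (Suc n) *\<^sub>R s ^ n else 0)" for n
  proof (induction n)
    case 0
    then show ?case by (simp add: s)
  next
    case (Suc n)
    have "real (Suc (Suc n)) = real (Suc n) + 1" by simp
    then show ?case
      unfolding power_Suc[of s "Suc n"] jpd_mult s Suc
      by (cases "c = X")
        (simp_all only: scaleR_left_distrib mult_scaleR_right scaleR_one mult_1 if_True if_False
          power_Suc mult_zero_left mult_zero_right add_0_left simp_thms)
  qed
  show ?thesis
  proof (cases n)
    case 0
    then show ?thesis using jpd_const[of c 1] by (simp add: taylor_def)
  next
    case (Suc m)
    have "(1 / fact (Suc m)) * real (Suc m) = (1 / fact m :: real)"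
      by (simp add: divide_simps)
    then show ?thesis unfolding Suc taylor_def s_def[symmetric] jpd_scaleR pow by simp
  qed
qed

lemma Dx_0 [simp]: "Dx 0 = 0" and Dx_pow_0 [simp]: "(Dx ^^ i) 0 = 0"
proof -
  show "Dx 0 = (0 :: 'a jfun)" by (simp add: Dx_def case_prod_beta')
  then show "(Dx ^^ i) 0 = (0 :: 'b jfun)"
    by (induction i) (simp_all add: Dx_def case_prod_beta')
qed

lemma Dx_pow_taylor: "(Dx ^^ i) (taylor x0 n) = (if i \<le> n then taylor x0 (n - i) else 0)"
proof (induction i)
  case (Suc i)
  then show ?case by (auto simp: Dx_def jpd_taylor case_prod_beta')
qed simp

lemma jval_taylor: "jval (taylor (z X) n) z = (if n = 0 then 1 else 0)"
proof -
  define s :: "'a jfun" where "s = coord_fun X + (- z X) *\<^sub>R 1"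
  have "jval s z = 0"
    unfolding s_def plus_jfun.rep_eq scaleR_jfun.rep_eq coord_fun.rep_eq one_jfun.rep_eq by simp
  then have "jval (s ^ n) z = 0 ^ n"
    by (induction n) (simp_all add: one_jfun.rep_eq times_jfun.rep_eq)
  then show ?thesis by (simp add: taylor_def s_def[symmetric] scaleR_jfun.rep_eq power_0_left del: scaleR_minus_left)
qed

lemma jval_sum: "jval (sum F I) z = (\<Sum>i\<in>I. jval (F i) z)"
  by (induction I rule: infinite_finite_induct) (auto simp: zero_jfun.rep_eq plus_jfun.rep_eq)

lemma bi_app_inject:
  assumes c: "bi_finite c" and d: "bi_finite d" and eq: "bi_app c = bi_app d"
  shows "c = d"
proof -
  define \<tau> where "\<tau> = (\<lambda>(z :: 'a point) (a :: 'a) (i :: nat) a'. if a' = a then taylor (z X) i else (0 :: 'a jfun))"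
  have jt: "jval ((Dx ^^ i') (\<tau> z a i a')) z = (if a' = a \<and> i' = i then 1 else 0)" for z a i a' i'
    by (auto simp: \<tau>_def Dx_pow_taylor jval_taylor zero_jfun.rep_eq)
  have "jval (bi_app e (\<tau> z a i) (\<tau> z b j) l) z = jval (e l (a, i) (b, j)) z"
    if "bi_finite e" for e z a i b j l
  proof -
    define P where "P = insert ((a, i), (b, j)) {(g, h). e l g h \<noteq> 0}"
    have "{(g, h). e l g h \<noteq> 0} \<subseteq> snd ` {(l, g, h). e l g h \<noteq> 0}" by force
    then have fP: "finite P"
      using that unfolding P_def bi_finite_def by (meson finite_insert finite_surj)
    have "bi_app e (\<tau> z a i) (\<tau> z b j) l = (\<Sum>((a', i'), (b', j'))\<in>P.
        e l (a', i') (b', j') * (Dx ^^ i') (\<tau> z a i a') * (Dx ^^ j') (\<tau> z b j b'))"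
      unfolding bi_app_def by (rule Sum_any.expand_superset) (use fP in \<open>auto simp: P_def\<close>)
    then have "jval (bi_app e (\<tau> z a i) (\<tau> z b j) l) z = (\<Sum>gh\<in>P.
        if gh = ((a, i), (b, j)) then jval (e l (a, i) (b, j)) z else 0)"
      by (auto simp: jval_sum times_jfun.rep_eq jt case_prod_beta' intro!: sum.cong)
    also have "\<dots> = jval (e l (a, i) (b, j)) z" using fP by (simp add: P_def)
    finally show ?thesis .
  qed
  then have "jval (c l (a, i) (b, j)) z = jval (d l (a, i) (b, j)) z" for l a i b j z
    using c d eq by metis
  then have "c l g h = d l g h" for l g h
    by (cases g; cases h) (simp add: jval_inject[symmetric] fun_eq_iff)
  then show ?thesis by (intro ext)
qed

definition bi_coeffs ::
  "(('m \<Rightarrow> 'm jfun) \<Rightarrow> ('m \<Rightarrow> 'm jfun) \<Rightarrow> 'm \<Rightarrow> 'm jfun) \<Rightarrow> 'm bicoeffs" where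
  "bi_coeffs \<Delta> = (THE c. bi_finite c \<and> bi_app c = \<Delta>)"


section \<open>Functions on the \<open>\<ell>\<^sup>*\<close>-covering\<close>

text \<open>The exterior algebra over the differential functions on the odd generators \<open>p\<^sup>j\<^sub>k\<close>, indexed
  by pairs \<open>(j, k)\<close>. An element maps each finite set \<open>S\<close> of generators to the coefficient of the
  product of the generators in \<open>S\<close>, taken in increasing order. The order is an auxiliary one,
  given by the enumeration \<^const>\<open>to_nat\<close>; \<open>invs S V\<close> counts the pairs that are out of order in the
  concatenation of \<open>S\<close> and \<open>V\<close>.\<close>

lifting_forget jfun.lifting

typedef 'm sfun =
  "{c :: 'm gen set \<Rightarrow> 'm jfun. finite {S. c S \<noteq> 0} \<and> (\<forall>S. c S \<noteq> 0 \<longrightarrow> finite S)}"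
  morphisms scoeff Abs_sfun
  by (rule exI[of _ "\<lambda>_. 0"]) simp

setup_lifting type_definition_sfun

definition invs :: "'a::countable set \<Rightarrow> 'a set \<Rightarrow> nat" where
  "invs S V = card {(g, h). g \<in> S \<and> h \<in> V \<and> to_nat h < to_nat g}"

lemma finite_invs: "finite S \<Longrightarrow> finite V \<Longrightarrow> finite {(g, h). g \<in> S \<and> h \<in> V \<and> P g h}"
  by (rule finite_subset[of _ "S \<times> V"]) auto

lemma invs_Un_left:
  assumes "finite S" "finite S'" "finite V" "S \<inter> S' = {}"
  shows "invs (S \<union> S') V = invs S V + invs S' V"
proof -
  have "{(g, h). g \<in> S \<union> S' \<and> h \<in> V \<and> to_nat h < to_nat g} =
    {(g, h). g \<in> S \<and> h \<in> V \<and> to_nat h < to_nat g} \<union> {(g, h). g \<in> S' \<and> h \<in> V \<and> to_nat h < to_nat g}"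
    by auto
  moreover have "{(g, h). g \<in> S \<and> h \<in> V \<and> to_nat h < to_nat g}
    \<inter> {(g, h). g \<in> S' \<and> h \<in> V \<and> to_nat h < to_nat g} = {}"
    using assms(4) by auto
  ultimately show ?thesis
    unfolding invs_def using assms by (simp add: card_Un_disjoint finite_invs)
qed

lemma invs_Un_right:
  assumes "finite S" "finite V" "finite V'" "V \<inter> V' = {}"
  shows "invs S (V \<union> V') = invs S V + invs S V'"
proof -
  have "{(g, h). g \<in> S \<and> h \<in> V \<union> V' \<and> to_nat h < to_nat g} =
    {(g, h). g \<in> S \<and> h \<in> V \<and> to_nat h < to_nat g} \<union> {(g, h). g \<in> S \<and> h \<in> V' \<and> to_nat h < to_nat g}"
    by auto
  moreover have "{(g, h). g \<in> S \<and> h \<in> V \<and> to_nat h < to_nat g}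
    \<inter> {(g, h). g \<in> S \<and> h \<in> V' \<and> to_nat h < to_nat g} = {}"
    using assms(4) by auto
  ultimately show ?thesis
    unfolding invs_def using assms by (simp add: card_Un_disjoint finite_invs)
qed

lemma invs_empty [simp]: "invs {} (V :: 'a::countable set) = 0" "invs (S :: 'a set) {} = 0"
  by (auto simp: invs_def)

lemma invs_assoc:
  assumes "finite A" "finite B" "finite C" "A \<inter> B = {}" "A \<inter> C = {}" "B \<inter> C = {}"
  shows "invs (A \<union> B) C + invs A B = invs A (B \<union> C) + invs B C"
  using assms by (simp add: invs_Un_left invs_Un_right)

definition smult_raw ::
  "('m::countable gen set \<Rightarrow> 'm jfun) \<Rightarrow> ('m gen set \<Rightarrow> 'm jfun) \<Rightarrow> 'm gen set \<Rightarrow> 'm jfun" where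
  "smult_raw c d S = (\<Sum>V\<in>Pow S. (-1) ^ invs V (S - V) * (c V * d (S - V)))"

lemma smult_raw_infinite: "infinite S \<Longrightarrow> smult_raw c d S = 0"
  by (simp add: smult_raw_def)

lemma smult_raw_assoc: "smult_raw (smult_raw a b) c S = smult_raw a (smult_raw b c) S"
proof (cases "finite S")
  case True
  let ?t = "\<lambda>V W. (-1) ^ (invs (V \<union> W) (S - (V \<union> W)) + invs V W) * (a V * b W * c (S - (V \<union> W)))"
  have "smult_raw (smult_raw a b) c S = (\<Sum>V\<in>Pow S. \<Sum>W\<in>Pow V. ?t W (V - W))"
    unfolding smult_raw_def sum_distrib_left sum_distrib_right
  proof (intro sum.cong refl)
    fix V W :: "'a gen set" assume "W \<in> Pow V"
    then have "W \<union> (V - W) = V" by auto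
    then show "(- 1) ^ invs V (S - V) * ((- 1) ^ invs W (V - W) * (a W * b (V - W)) * c (S - V)) =
      ?t W (V - W)"
      by (simp add: power_add mult_ac)
  qed
  also have "\<dots> = (\<Sum>(V, W)\<in>Sigma (Pow S) Pow. ?t W (V - W))"
    using True by (subst sum.Sigma) (auto intro: finite_subset)
  also have "\<dots> = (\<Sum>(V, W)\<in>Sigma (Pow S) (\<lambda>V. Pow (S - V)). ?t V W)"
    by (rule sum.reindex_bij_witness[where i = "\<lambda>(V, W). (V \<union> W, V)" and j = "\<lambda>(V, W). (W, V - W)"])
      auto
  also have "\<dots> = (\<Sum>V\<in>Pow S. \<Sum>W\<in>Pow (S - V). ?t V W)"
    using True by (subst sum.Sigma) auto
  also have "\<dots> = smult_raw a (smult_raw b c) S"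
    unfolding smult_raw_def sum_distrib_left sum_distrib_right
  proof (intro sum.cong refl)
    fix V W :: "'a gen set" assume VW: "V \<in> Pow S" "W \<in> Pow (S - V)"
    then have e: "S - V - W = S - (V \<union> W)" "W \<union> (S - (V \<union> W)) = S - V" by auto
    have "finite V" "finite W" using VW True by (auto intro: finite_subset)
    then have "invs (V \<union> W) (S - (V \<union> W)) + invs V W = invs V (S - V) + invs W (S - (V \<union> W))"
      using invs_assoc[of V W "S - (V \<union> W)"] VW True unfolding e(2) by auto
    then show "?t V W =
      (- 1) ^ invs V (S - V) * (a V * ((- 1) ^ invs W (S - V - W) * (b W * c (S - V - W))))"
      by (simp add: power_add mult_ac e(1))
  qed
  finally show ?thesis .
qed (simp add: smult_raw_infinite)

lemma smult_raw_one:
  assumes "\<And>S. infinite S \<Longrightarrow> c S = 0"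
  shows "smult_raw (\<lambda>S. if S = {} then 1 else 0) c = c"
    and "smult_raw c (\<lambda>S. if S = {} then 1 else 0) = c"
proof (safe intro!: ext)
  fix S
  show "smult_raw (\<lambda>S. if S = {} then 1 else 0) c S = c S"
  proof (cases "finite S")
    case True
    have "smult_raw (\<lambda>S. if S = {} then 1 else 0) c S = (\<Sum>V\<in>Pow S. if V = {} then c S else 0)"
      unfolding smult_raw_def by (intro sum.cong) auto
    with True show ?thesis by simp
  qed (simp add: assms smult_raw_infinite)
  show "smult_raw c (\<lambda>S. if S = {} then 1 else 0) S = c S"
  proof (cases "finite S")
    case True
    have "smult_raw c (\<lambda>S. if S = {} then 1 else 0) S = (\<Sum>V\<in>Pow S. if V = S then c S else 0)"
      unfolding smult_raw_def by (intro sum.cong) auto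
    with True show ?thesis by simp
  qed (simp add: assms smult_raw_infinite)
qed

instantiation sfun :: (countable) "{ring_1, real_algebra_1}"
begin

lift_definition zero_sfun :: "'a sfun" is "\<lambda>_. 0" by simp

lift_definition one_sfun :: "'a sfun" is "\<lambda>S. if S = {} then 1 else 0"
  by simp

lift_definition plus_sfun :: "'a sfun \<Rightarrow> 'a sfun \<Rightarrow> 'a sfun" is "\<lambda>c d S. c S + d S"
proof -
  fix c d :: "'a gen set \<Rightarrow> 'a jfun"
  assume a: "finite {S. c S \<noteq> 0} \<and> (\<forall>S. c S \<noteq> 0 \<longrightarrow> finite S)"
    "finite {S. d S \<noteq> 0} \<and> (\<forall>S. d S \<noteq> 0 \<longrightarrow> finite S)"
  have "finite {S. c S + d S \<noteq> 0}"
    by (rule finite_subset[of _ "{S. c S \<noteq> 0} \<union> {S. d S \<noteq> 0}"]) (use a in auto)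
  moreover have "finite S" if "c S + d S \<noteq> 0" for S
    using a that by (cases "c S = 0") auto
  ultimately show "finite {S. c S + d S \<noteq> 0} \<and> (\<forall>S. c S + d S \<noteq> 0 \<longrightarrow> finite S)" by blast
qed

lift_definition scaleR_sfun :: "real \<Rightarrow> 'a sfun \<Rightarrow> 'a sfun" is "\<lambda>r c S. r *\<^sub>R c S"
  by (auto elim: rev_finite_subset)

lift_definition times_sfun :: "'a sfun \<Rightarrow> 'a sfun \<Rightarrow> 'a sfun" is smult_raw
proof -
  fix c d :: "'a gen set \<Rightarrow> 'a jfun"
  assume a: "finite {S. c S \<noteq> 0} \<and> (\<forall>S. c S \<noteq> 0 \<longrightarrow> finite S)"
    "finite {S. d S \<noteq> 0} \<and> (\<forall>S. d S \<noteq> 0 \<longrightarrow> finite S)"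
  have "{S. smult_raw c d S \<noteq> 0} \<subseteq> (\<lambda>(V, W). V \<union> W) ` ({S. c S \<noteq> 0} \<times> {S. d S \<noteq> 0})"
  proof
    fix S assume "S \<in> {S. smult_raw c d S \<noteq> 0}"
    then obtain V where "V \<subseteq> S" "(-1) ^ invs V (S - V) * (c V * d (S - V)) \<noteq> 0"
      unfolding smult_raw_def by (auto elim: sum.not_neutral_contains_not_neutral)
    then have "S = V \<union> (S - V)" "c V \<noteq> 0" "d (S - V) \<noteq> 0" by auto
    then show "S \<in> (\<lambda>(V, W). V \<union> W) ` ({S. c S \<noteq> 0} \<times> {S. d S \<noteq> 0})" by blast
  qed
  then have "finite {S. smult_raw c d S \<noteq> 0}"
    using a by (meson finite_SigmaI finite_surj)
  then show "finite {S. smult_raw c d S \<noteq> 0} \<and> (\<forall>S. smult_raw c d S \<noteq> 0 \<longrightarrow> finite S)"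
    using smult_raw_infinite by blast
qed

definition uminus_sfun :: "'a sfun \<Rightarrow> 'a sfun" where
  "uminus_sfun F = (-1) *\<^sub>R F"

definition minus_sfun :: "'a sfun \<Rightarrow> 'a sfun \<Rightarrow> 'a sfun" where
  "minus_sfun F G = F + (-1) *\<^sub>R G"

instance
proof
  fix a b c :: "'a sfun" and r s :: real
  show "a + b + c = a + (b + c)" "a + b = b + a" "0 + a = a"
    "r *\<^sub>R (a + b) = r *\<^sub>R a + r *\<^sub>R b" "(r + s) *\<^sub>R a = r *\<^sub>R a + s *\<^sub>R a"
    "r *\<^sub>R s *\<^sub>R a = (r * s) *\<^sub>R a" "1 *\<^sub>R a = a"
    by (transfer; simp add: fun_eq_iff algebra_simps)+
  show "- a + a = 0" "a - b = a + - b"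
    unfolding uminus_sfun_def minus_sfun_def by (transfer; simp add: fun_eq_iff)+
  show "a * b * c = a * (b * c)"
    by transfer (simp add: fun_eq_iff smult_raw_assoc)
  show "1 * a = a" "a * 1 = a"
    by (transfer; use smult_raw_one in blast)+
  show "(a + b) * c = a * c + b * c" "a * (b + c) = a * b + a * c"
    "r *\<^sub>R a * b = r *\<^sub>R (a * b)" "a * r *\<^sub>R b = r *\<^sub>R (a * b)"
    by (transfer;
        simp add: fun_eq_iff smult_raw_def algebra_simps sum.distrib scaleR_sum_right)+
  have "scoeff (0 :: 'a sfun) {} \<noteq> scoeff (1 :: 'a sfun) {}" by transfer simp
  then show "(0 :: 'a sfun) \<noteq> 1" by auto
qed

end

lift_definition emb :: "'m jfun \<Rightarrow> 'm sfun" is "\<lambda>a S. if S = {} then a else 0"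
  by simp

lift_definition odd_var :: "'m \<Rightarrow> nat \<Rightarrow> 'm sfun" is "\<lambda>j k S. if S = {(j, k)} then 1 else 0"
  by simp

text \<open>Action of an additive map on the coefficients.\<close>

lift_definition coeffwise :: "('m jfun \<Rightarrow> 'm jfun) \<Rightarrow> 'm sfun \<Rightarrow> 'm sfun"
  is "\<lambda>d c S. if c S = 0 then 0 else d (c S)"
  by (auto elim: rev_finite_subset)

abbreviation spd :: "'m coord \<Rightarrow> 'm sfun \<Rightarrow> 'm sfun" where
  "spd c \<equiv> coeffwise (jpd c)"

text \<open>The left derivative with respect to \<open>p\<^sup>j\<^sub>k\<close>: the generator is first moved to the front.\<close>

lift_definition odd_pd :: "'m::countable \<Rightarrow> nat \<Rightarrow> 'm sfun \<Rightarrow> 'm sfun"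
  is "\<lambda>j k c S. if (j, k) \<in> S then 0 else (-1) ^ invs {(j, k)} S * c (insert (j, k) S)"
proof -
  fix j :: 'm and k and c :: "'m gen set \<Rightarrow> 'm jfun"
  let ?d = "\<lambda>S. if (j, k) \<in> S then 0 else (-1) ^ invs {(j, k)} S * c (insert (j, k) S)"
  assume a: "finite {S. c S \<noteq> 0} \<and> (\<forall>S. c S \<noteq> 0 \<longrightarrow> finite S)"
  have d: "(j, k) \<notin> S \<and> c (insert (j, k) S) \<noteq> 0" if "?d S \<noteq> 0" for S
    using that by (cases "(j, k) \<in> S") (simp_all only: if_True if_False, auto dest: mult_not_zero)
  have "{S. ?d S \<noteq> 0} \<subseteq> (\<lambda>S. S - {(j, k)}) ` {S. c S \<noteq> 0}"
  proof
    fix S assume "S \<in> {S. ?d S \<noteq> 0}"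
    then have "S = insert (j, k) S - {(j, k)}" "insert (j, k) S \<in> {S. c S \<noteq> 0}"
      using d[of S] by simp_all
    then show "S \<in> (\<lambda>S. S - {(j, k)}) ` {S. c S \<noteq> 0}" by (rule image_eqI)
  qed
  then have "finite {S. ?d S \<noteq> 0}"
    by (rule finite_subset) (rule finite_imageI, rule conjunct1[OF a])
  moreover have "finite S" if "?d S \<noteq> 0" for S
    using conjunct2[OF a, rule_format, of "insert (j, k) S"] d[OF that] by simp
  ultimately show "finite {S. ?d S \<noteq> 0} \<and> (\<forall>S. ?d S \<noteq> 0 \<longrightarrow> finite S)"
    by (intro conjI allI impI)
qed

lemma smult_raw_single:
  assumes "finite S"
  shows "smult_raw (\<lambda>V. if V = {g} then 1 else 0) c S =
    (if g \<in> S then (-1) ^ invs {g} (S - {g}) * c (S - {g}) else 0)"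
proof -
  have "smult_raw (\<lambda>V. if V = {g} then 1 else 0) c S =
    (\<Sum>V\<in>Pow S. if V = {g} then (-1) ^ invs {g} (S - {g}) * c (S - {g}) else 0)"
    unfolding smult_raw_def by (intro sum.cong) auto
  also have "\<dots> = (if g \<in> S then (-1) ^ invs {g} (S - {g}) * c (S - {g}) else 0)"
    using assms by (subst sum.delta) auto
  finally show ?thesis .
qed

lemma invs_singletons:
  assumes "g \<noteq> h"
  shows "invs {g} {h} + invs {h} {g} = 1"
proof -
  have "invs {a} {b} = (if to_nat b < to_nat a then 1 else 0)" for a b :: 'a
  proof -
    have "{(g, h). g \<in> {a} \<and> h \<in> {b} \<and> to_nat h < to_nat g} =
      (if to_nat b < to_nat a then {(a, b)} else {})" by auto
    then show ?thesis unfolding invs_def by (auto split: if_splits)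
  qed
  moreover have "to_nat g \<noteq> to_nat h" using assms by simp
  ultimately show ?thesis by auto
qed

lemma sign_singletons:
  assumes "g \<noteq> h"
  shows "(-1 :: 'a::comm_ring_1) ^ invs {g} {h} = - ((-1) ^ invs {h} {g})"
proof -
  have "invs {g} {h} = 0 \<and> invs {h} {g} = 1 \<or> invs {g} {h} = 1 \<and> invs {h} {g} = 0"
    using invs_singletons[OF assms] by arith
  then show ?thesis by auto
qed

lemma sign_swap:
  assumes "finite S" "g \<noteq> h" "g \<notin> S" "h \<notin> S"
  shows "(-1 :: 'a::comm_ring_1) ^ invs {g} (insert h S) * (-1) ^ invs {h} (insert g S) =
    - ((-1) ^ invs {h} S * (-1) ^ invs {g} S)"
proof -
  have "invs {g} (insert h S) = invs {g} {h} + invs {g} S"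
    "invs {h} (insert g S) = invs {h} {g} + invs {h} S"
    using invs_Un_right[of "{g}" "{h}" S] invs_Un_right[of "{h}" "{g}" S] assms by auto
  then have "(-1 :: 'a) ^ invs {g} (insert h S) * (-1) ^ invs {h} (insert g S) =
    (-1) ^ (invs {g} {h} + invs {h} {g}) * ((-1) ^ invs {h} S * (-1) ^ invs {g} S)"
    by (simp add: power_add mult_ac)
  then show ?thesis using invs_singletons[OF assms(2)] by simp
qed

text \<open>The rule \<open>\<partial>\<^sub>g (p\<^sub>h F) = \<delta>\<^sub>g\<^sub>h F - p\<^sub>h \<partial>\<^sub>g F\<close>.\<close>

lemma odd_pd_odd_var_mult:
  "odd_pd j k (odd_var j' k' * F) =
     (if (j, k) = (j', k') then F else 0) - odd_var j' k' * odd_pd j k F"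
proof -
  let ?g = "(j, k)" and ?h = "(j', k')"
  have "odd_pd j k (odd_var j' k' * F) + odd_var j' k' * odd_pd j k F =
    (if ?g = ?h then F else 0)"
  proof transfer
    fix j j' :: 'a and k k' :: nat and c :: "'a gen set \<Rightarrow> 'a jfun"
    assume c: "finite {S. c S \<noteq> 0} \<and> (\<forall>S. c S \<noteq> 0 \<longrightarrow> finite S)"
    define g h where gh: "g = (j, k)" "h = (j', k')"
    define p where "p = (\<lambda>S. if S = {h} then 1 else (0 :: 'a jfun))"
    define d where "d = (\<lambda>c S. if g \<in> S then 0 else (-1) ^ invs {g} S * (c (insert g S) :: 'a jfun))"
    have "d (smult_raw p c) S + smult_raw p (d c) S = (if g = h then c else (\<lambda>_. 0)) S" for S
    proof (cases "finite S")
      case False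
      then show ?thesis using c by (auto simp: d_def smult_raw_infinite)
    next
      case True
      note pS = smult_raw_single[of _ h, folded p_def]
      consider "g = h" | "g \<noteq> h" "g \<in> S \<or> h \<notin> S" | "g \<noteq> h" "g \<notin> S" "h \<in> S" by blast
      then show ?thesis
      proof cases
        case 1
        then show ?thesis using True
          by (cases "g \<in> S")
            (auto simp: d_def pS insert_absorb mult.assoc[symmetric] power_mult_distrib[symmetric])
      next
        case 2
        then show ?thesis using True by (auto simp: d_def pS)
      next
        case 3
        define R where "R = S - {h}"
        have R: "S = insert h R" "h \<notin> R" "g \<notin> R" "finite R" using 3 True by (auto simp: R_def)
        have e: "insert g (insert h R) - {h} = insert g R" using R 3 by auto
        show ?thesis
          using 3 R sign_swap[of R g h, where 'a = "'a jfun"] by (simp add: d_def pS e mult.assoc[symmetric])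
      qed
    qed
    then show "(\<lambda>S. (if (j, k) \<in> S then 0 else (- 1) ^ invs {(j, k)} S *
          smult_raw (\<lambda>S. if S = {(j', k')} then 1 else 0) c (insert (j, k) S)) +
        smult_raw (\<lambda>S. if S = {(j', k')} then 1 else 0)
          (\<lambda>S. if (j, k) \<in> S then 0 else (- 1) ^ invs {(j, k)} S * c (insert (j, k) S)) S) =
      (if (j, k) = (j', k') then c else (\<lambda>_. 0))"
      unfolding fun_eq_iff d_def p_def gh by simp
  qed
  then show ?thesis by (simp add: algebra_simps)
qed

lemma odd_var_anticommute: "odd_var j k * odd_var j' k' = - (odd_var j' k' * odd_var j k)"
proof -
  have "odd_var j k * odd_var j' k' + odd_var j' k' * odd_var j k = 0"
  proof transfer
    fix j j' :: 'a and k k' :: nat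
    define p where "p = (\<lambda>(g :: 'a gen) S. if S = {g} then 1 else (0 :: 'a jfun))"
    define g h where gh: "g = (j, k)" "h = (j', k')"
    have "smult_raw (p g) (p h) S + smult_raw (p h) (p g) S = 0" for S
    proof (cases "finite S")
      case True
      have eq: "S - {a} = {b} \<and> a \<in> S \<longleftrightarrow> a \<noteq> b \<and> S = {a, b}" for a b by auto
      have *: "smult_raw (p a) (p b) S = (if a \<noteq> b \<and> S = {a, b} then (-1) ^ invs {a} {b} else 0)"
        for a b
        unfolding p_def smult_raw_single[OF True] using eq[of a b] by auto
      show ?thesis
        using sign_singletons[of g h, where 'a = "'a jfun"] by (auto simp: * insert_commute)
    qed (simp add: smult_raw_infinite)
    then show "(\<lambda>S. smult_raw (\<lambda>S. if S = {(j, k)} then 1 else 0)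
          (\<lambda>S. if S = {(j', k')} then 1 else 0) S +
        smult_raw (\<lambda>S. if S = {(j', k')} then 1 else 0)
          (\<lambda>S. if S = {(j, k)} then 1 else 0) S) = (\<lambda>_. 0 :: 'a jfun)"
      unfolding fun_eq_iff p_def gh by simp
  qed
  then show ?thesis by (simp add: eq_neg_iff_add_eq_0)
qed

definition sDx :: "'m::countable sfun \<Rightarrow> 'm sfun" where
  "sDx F = coeffwise Dx F + Sum_any (\<lambda>(j, k). odd_var j (Suc k) * odd_pd j k F)"

definition sell :: "('m::finite \<Rightarrow> 'm sfun) \<Rightarrow> ('m \<Rightarrow> 'm sfun) \<Rightarrow> 'm \<Rightarrow> 'm sfun" where
  "sell H \<eta> l = Sum_any (\<lambda>(j, k). spd (U j k) (H l) * (sDx ^^ k) (\<eta> j))"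

text \<open>The vector \<open>\<ell>\<^sup>*\<^sub>H(p)\<close>. The covering equation reads \<open>p\<^sub>t = - sell_adj_p (emb \<circ> f)\<close>.\<close>

definition sell_adj_p :: "('m::finite \<Rightarrow> 'm sfun) \<Rightarrow> 'm \<Rightarrow> 'm sfun" where
  "sell_adj_p H j =
     Sum_any (\<lambda>(k, l). (-1) ^ k * (sDx ^^ k) (spd (U j k) (H l) * odd_var l 0))"

definition sDt :: "('m::finite \<Rightarrow> 'm jfun) \<Rightarrow> 'm sfun \<Rightarrow> 'm sfun" where
  "sDt f F = coeffwise (Dt f) F
     - Sum_any (\<lambda>(j, k). (sDx ^^ k) (sell_adj_p (emb \<circ> f) j) * odd_pd j k F)"

definition ham :: "'m::finite operator \<Rightarrow> 'm \<Rightarrow> 'm sfun" where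
  "ham A l = Sum_any (\<lambda>(i, j). emb (A l i j) * odd_var j i)"

definition shadow :: "('m::finite \<Rightarrow> 'm jfun) \<Rightarrow> ('m \<Rightarrow> 'm sfun) \<Rightarrow> bool" where
  "shadow f H \<longleftrightarrow> (\<forall>l. sDt f (H l) - sell (emb \<circ> f) H l = 0)"

text \<open>The odd derivation with \<open>u\<close>-components \<open>H\<close> and \<open>p\<close>-components \<open>- \<ell>\<^sup>*\<^sub>H(p) / 2\<close>.\<close>

definition odd_field :: "('m::finite \<Rightarrow> 'm sfun) \<Rightarrow> 'm sfun \<Rightarrow> 'm sfun" where
  "odd_field H F =
     Sum_any (\<lambda>(j, k). (sDx ^^ k) (H j) * spd (U j k) F)
     + Sum_any (\<lambda>(j, k). (sDx ^^ k) (- ((1/2) *\<^sub>R sell_adj_p H j)) * odd_pd j k F)"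

definition jacobi :: "('m::finite \<Rightarrow> 'm sfun) \<Rightarrow> ('m \<Rightarrow> 'm sfun) \<Rightarrow> 'm \<Rightarrow> 'm sfun" where
  "jacobi H K l = odd_field H (K l) + odd_field K (H l)"


text \<open>The factor \<open>1/2\<close> compensates that \<open>p\<^sup>a\<^sub>i p\<^sup>b\<^sub>j\<close> stands for the skew-symmetric operator
  \<open>D\<^sub>x\<^sup>i(\<psi>\<^sub>1\<^sup>a) D\<^sub>x\<^sup>j(\<psi>\<^sub>2\<^sup>b) - D\<^sub>x\<^sup>j(\<psi>\<^sub>1\<^sup>b) D\<^sub>x\<^sup>i(\<psi>\<^sub>2\<^sup>a)\<close>.\<close>

definition ham2 ::
  "(('m::finite \<Rightarrow> 'm jfun) \<Rightarrow> ('m \<Rightarrow> 'm jfun) \<Rightarrow> 'm \<Rightarrow> 'm jfun) \<Rightarrow> 'm \<Rightarrow> 'm sfun" where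
  "ham2 \<Delta> l = (1/2) *\<^sub>R Sum_any (\<lambda>((a, i), (b, j)).
     emb (bi_coeffs \<Delta> l (a, i) (b, j)) * odd_var a i * odd_var b j)"

end

theory Submission
  imports Defs
begin

text \<open>For \<open>\<psi>\<close> let \<open>contract \<psi>\<close> be the odd derivation over the differential functions that replaces
  \<open>p\<^sup>j\<^sub>k\<close> by \<open>D\<^sub>x\<^sup>k(\<psi>\<^sup>j)\<close>. Contracting an element that is quadratic in the \<open>p\<^sup>j\<^sub>k\<close> with \<open>\<psi>\<^sub>1\<close> and then with
  \<open>\<psi>\<^sub>2\<close> gives the corresponding skew-symmetric bilinear operator, and Euler's identity in the odd
  variables recovers the element from this operator. As contractions commute with the total derivative,
  contracting the Jacobi bracket is a direct computation. It produces \<open>\<ell>\<^sup>*\<^bsub>A,\<psi>1\<^esub>(\<psi>\<^sub>2)\<close> only in the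
  antisymmetrised form \<open>(\<ell>\<^sup>*\<^bsub>A,\<psi>1\<^esub>(\<psi>\<^sub>2) - \<ell>\<^sup>*\<^bsub>A,\<psi>2\<^esub>(\<psi>\<^sub>1)) / 2\<close>, so it remains to see that
  \<open>\<ell>\<^sup>*\<^bsub>A,\<psi>1\<^esub>(\<psi>\<^sub>2)\<close> is skew-symmetric in \<open>\<psi>\<^sub>1\<close>, \<open>\<psi>\<^sub>2\<close> for skew-adjoint \<open>A\<close>. This follows from the relation
  between the coefficients of \<open>A\<close> and \<open>A\<^sup>*\<close> and from \<open>\<ell>\<^sup>*\<^bsub>D a\<^esub> = - \<ell>\<^sup>*\<^sub>a \<circ> D\<close>, which rests on the symmetry
  of second partial derivatives.\<close>

section \<open>Partial and total derivatives\<close>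

lemma mixed_difference_mvt:
  fixes F :: "real \<Rightarrow> real \<Rightarrow> real"
  assumes h: "h > 0"
    and Fs: "\<And>s t. ((\<lambda>s. F s t) has_real_derivative Fs s t) (at s)"
    and Fst: "\<And>s t. ((\<lambda>t. Fs s t) has_real_derivative Fst s t) (at t)"
  shows "\<exists>\<xi> \<eta>. \<bar>\<xi> - a\<bar> \<le> h \<and> \<bar>\<eta> - b\<bar> \<le> h \<and>
    F (a + h) (b + h) - F (a + h) b - F a (b + h) + F a b = h * h * Fst \<xi> \<eta>"
proof -
  \<comment> \<open>The mean value theorem is applied first to the increment of \<open>F\<close> in
    the second variable, as a function of the first, and then to \<open>Fs \<xi>\<close>.\<close>
  obtain \<xi> where \<xi>: "a < \<xi>" "\<xi> < a + h"
    "(F (a + h) (b + h) - F (a + h) b) - (F a (b + h) - F a b) = (a + h - a) * (Fs \<xi> (b + h) - Fs \<xi> b)"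
    using MVT2[OF _ DERIV_diff[OF Fs Fs], of a "a + h" "b + h" b] h by auto
  obtain \<eta> where \<eta>: "b < \<eta>" "\<eta> < b + h" "Fs \<xi> (b + h) - Fs \<xi> b = (b + h - b) * Fst \<xi> \<eta>"
    using MVT2[of b "b + h" "Fs \<xi>" "Fst \<xi>"] h Fst by auto
  show ?thesis
    using \<xi> \<eta> by (intro exI[of _ \<xi>] exI[of _ \<eta>]) auto
qed

text \<open>The second difference over a square of side \<open>h\<close> does not depend on the
  order in which the differences are taken. It is \<open>h * h\<close> times either mixed derivative
  at points of the square, and these points tend to \<open>(a, b)\<close> as \<open>h\<close> tends
  to zero.\<close>

lemma mixed_derivatives_commute:
  fixes F :: "real \<Rightarrow> real \<Rightarrow> real"
  assumes Fs: "\<And>s t. ((\<lambda>s. F s t) has_real_derivative Fs s t) (at s)"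
    and Fst: "\<And>s t. ((\<lambda>t. Fs s t) has_real_derivative Fst s t) (at t)"
    and Ft: "\<And>s t. ((\<lambda>t. F s t) has_real_derivative Ft s t) (at t)"
    and Fts: "\<And>s t. ((\<lambda>s. Ft s t) has_real_derivative Fts s t) (at s)"
    and cont: "continuous_on UNIV (\<lambda>(s, t). Fst s t)" "continuous_on UNIV (\<lambda>(s, t). Fts s t)"
  shows "Fst a b = Fts a b"
proof -
  define h where "h = (\<lambda>n. 1 / real (Suc n))"
  have h: "h n > 0" for n by (simp add: h_def)
  have h0: "h \<longlonglongrightarrow> 0" unfolding h_def using LIMSEQ_inverse_real_of_nat by (simp add: inverse_eq_divide)
  have "\<exists>p q. dist p (a, b) \<le> 2 * h n \<and> dist q (a, b) \<le> 2 * h n \<and> Fst (fst p) (snd p) = Fts (fst q) (snd q)" for n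
  proof -
    have dist: "dist (x, y) (a, b) \<le> 2 * h n" if "\<bar>x - a\<bar> \<le> h n" "\<bar>y - b\<bar> \<le> h n" for x y
      using sqrt_sum_squares_le_sum_abs[of "x - a" "y - b"] that by (simp add: dist_Pair_Pair dist_real_def)
    obtain x y where xy: "\<bar>x - a\<bar> \<le> h n" "\<bar>y - b\<bar> \<le> h n"
      "F (a + h n) (b + h n) - F (a + h n) b - F a (b + h n) + F a b = h n * h n * Fst x y"
      using mixed_difference_mvt[OF h Fs Fst] by blast
    \<comment> \<open>The same mean value lemma with the roles of the variables exchanged, whence
      the order \<open>y'\<close>, \<open>x'\<close>.\<close>
    obtain y' x' where xy': "\<bar>y' - b\<bar> \<le> h n" "\<bar>x' - a\<bar> \<le> h n"
      "F (a + h n) (b + h n) - F a (b + h n) - F (a + h n) b + F a b = h n * h n * Fts x' y'"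
      using mixed_difference_mvt[OF h Ft Fts] by blast
    have "h n * h n * Fst x y = h n * h n * Fts x' y'" using xy(3) xy'(3) by linarith
    then have "Fst x y = Fts x' y'" using h[of n] by simp
    then show ?thesis
      using dist[OF xy(1,2)] dist[OF xy'(2,1)]
      by (intro exI[of _ "(x, y)"] exI[of _ "(x', y')"]) simp
  qed
  then obtain p q where pq: "\<And>n. dist (p n) (a, b) \<le> 2 * h n" "\<And>n. dist (q n) (a, b) \<le> 2 * h n"
    "\<And>n. Fst (fst (p n)) (snd (p n)) = Fts (fst (q n)) (snd (q n))"
    by metis
  have lim: "v \<longlonglongrightarrow> (a, b)" if "\<And>n. dist (v n) (a, b) \<le> 2 * h n" for v
    using tendsto_mult_right_zero[OF h0, of 2] that
    by (subst tendsto_dist_iff) (rule Lim_null_comparison[of _ "\<lambda>n. 2 * h n"], auto)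
  have "(\<lambda>n. (\<lambda>(s, t). Fst s t) (p n)) \<longlonglongrightarrow> (\<lambda>(s, t). Fst s t) (a, b)"
    by (rule continuous_on_tendsto_compose[OF cont(1)]) (auto intro!: lim pq)
  moreover have "(\<lambda>n. (\<lambda>(s, t). Fts s t) (q n)) \<longlonglongrightarrow> (\<lambda>(s, t). Fts s t) (a, b)"
    by (rule continuous_on_tendsto_compose[OF cont(2)]) (auto intro!: lim pq)
  ultimately show ?thesis using LIMSEQ_unique by (simp add: case_prod_beta' pq(3))
qed

text \<open>\<open>Ck\<close> gives differentiability only at the value that the point itself has in
  the coordinate \<open>c\<close>; used at \<open>z(c := s)\<close>, it covers the whole coordinate
  line.\<close>

lemma pd_has_derivative:
  assumes "diff_function F"
  shows "((\<lambda>s. F (z(c := s))) has_real_derivative pd c F (z(c := s))) (at s)"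
proof -
  have "Ck (Suc 0) F" using assms by (simp only: diff_function_def)
  then have "(\<lambda>s'. F ((z(c := s))(c := s'))) field_differentiable at ((z(c := s)) c)"
    unfolding Ck.simps by blast
  then show ?thesis
    unfolding pd_def using field_differentiable_derivI by fastforce
qed

lemma diff_function_pd: "diff_function F \<Longrightarrow> diff_function (pd c F)"
proof -
  assume "diff_function F"
  then have "finitary F" "\<And>n. Ck (Suc n) F" by (simp_all only: diff_function_def)
  then show "diff_function (pd c F)" by (simp add: diff_function_def finitary_pd)
qed

text \<open>The inclusion of a coordinate plane into the product space is continuous in each
  coordinate, so continuity in the product topology restricts to joint continuity in two
  variables.\<close>

lemma continuous_on_update2:
  fixes G :: "'m point \<Rightarrow> real"
  assumes "diff_function G"
  shows "continuous_on UNIV (\<lambda>(s, t). G (z(c := s, d := t)))"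
proof -
  have "continuous_on UNIV G" using assms Ck_continuous by (auto simp: diff_function_def)
  moreover have "continuous_on UNIV (\<lambda>x::real \<times> real. z(c := fst x, d := snd x))"
  proof (rule continuous_on_coordinatewise_then_product)
    fix i
    show "continuous_on UNIV (\<lambda>x::real \<times> real. (z(c := fst x, d := snd x)) i)"
      by (cases "i = d"; cases "i = c") (auto intro!: continuous_intros)
  qed
  ultimately show ?thesis
    unfolding case_prod_beta' by (rule continuous_on_compose2) auto
qed

lemma pd_commute:
  assumes F: "diff_function F"
  shows "pd c (pd d F) = pd d (pd c F)"
proof (cases "c = d")
  case False
  show ?thesis
  proof
    fix z :: "'a point"
    have eq: "z(c := s, d := t) = z(d := t, c := s)" for s t using False by (rule fun_upd_twist)
    note [simp] = pd_has_derivative F diff_function_pd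
    \<comment> \<open>The point \<open>z\<close> is written as a point of the plane through itself,
      to fit the two-variable lemma.\<close>
    have "pd d (pd c F) (z(c := z c, d := z d)) = pd c (pd d F) (z(c := z c, d := z d))"
    proof (rule mixed_derivatives_commute[where F = "\<lambda>s t. F (z(c := s, d := t))"
          and Fs = "\<lambda>s t. pd c F (z(c := s, d := t))" and Ft = "\<lambda>s t. pd d F (z(c := s, d := t))"
          and Fst = "\<lambda>s t. pd d (pd c F) (z(c := s, d := t))"
          and Fts = "\<lambda>s t. pd c (pd d F) (z(c := s, d := t))"])
      show "((\<lambda>s. F (z(c := s, d := t))) has_real_derivative pd c F (z(c := s, d := t))) (at s)"
        "((\<lambda>s. pd d F (z(c := s, d := t))) has_real_derivative pd c (pd d F) (z(c := s, d := t))) (at s)"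
        for s t by (simp_all add: eq)
    qed (simp_all add: continuous_on_update2)
    then show "pd c (pd d F) z = pd d (pd c F) z" by simp
  qed
qed simp

lemma jpd_commute: "jpd c (jpd d F) = jpd d (jpd c F)"
  using pd_commute[of "jval F" c d] jval[of F] by (simp add: jval_inject[symmetric] jpd.rep_eq)

lemma jpd_sum: "jpd c (sum F I) = (\<Sum>i\<in>I. jpd c (F i))"
  by (induction I rule: infinite_finite_induct) (simp_all add: jpd_add)

section \<open>Order of differential functions and finite forms of the sums\<close>

lemma Sum_any_pair:
  fixes g :: "'a::finite \<Rightarrow> nat \<Rightarrow> 'b::comm_monoid_add"
  assumes "\<And>j k. K \<le> k \<Longrightarrow> g j k = 0"
  shows "Sum_any (\<lambda>(j, k). g j k) = (\<Sum>j\<in>UNIV. \<Sum>k<K. g j k)"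
    and "Sum_any (\<lambda>(k, j). g j k) = (\<Sum>j\<in>UNIV. \<Sum>k<K. g j k)"
proof -
  have "{a. (case a of (j, k) \<Rightarrow> g j k) \<noteq> 0} \<subseteq> UNIV \<times> {..<K}"
    using assms by (auto simp: not_le[symmetric])
  then have "Sum_any (\<lambda>(j, k). g j k) = (\<Sum>(j, k)\<in>UNIV \<times> {..<K}. g j k)"
    by (intro Sum_any.expand_superset) auto
  then show "Sum_any (\<lambda>(j, k). g j k) = (\<Sum>j\<in>UNIV. \<Sum>k<K. g j k)"
    by (simp add: sum.cartesian_product)
  have "{a. (case a of (k, j) \<Rightarrow> g j k) \<noteq> 0} \<subseteq> {..<K} \<times> UNIV"
    using assms by (auto simp: not_le[symmetric])
  then have "Sum_any (\<lambda>(k, j). g j k) = (\<Sum>(k, j)\<in>{..<K} \<times> UNIV. g j k)"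
    by (intro Sum_any.expand_superset) auto
  then show "Sum_any (\<lambda>(k, j). g j k) = (\<Sum>j\<in>UNIV. \<Sum>k<K. g j k)"
    by (simp add: sum.cartesian_product[symmetric] sum.swap[of _ UNIV])
qed

text \<open>Any strict bound is allowed, not just the least one, so that several functions can share
  one range of summation and their sums can be combined termwise.\<close>

definition jorder :: "nat \<Rightarrow> 'm jfun \<Rightarrow> bool" where
  "jorder K F \<longleftrightarrow> (\<forall>j k. K \<le> k \<longrightarrow> jpd (U j k) F = 0)"

lemma jorderD: "jorder K F \<Longrightarrow> K \<le> k \<Longrightarrow> jpd (U j k) F = 0"
  by (simp add: jorder_def)

lemma jorder_mono: "jorder K F \<Longrightarrow> K \<le> K' \<Longrightarrow> jorder K' F"
  by (simp add: jorder_def)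

lemma jorder_ex: "\<exists>K. jorder K F"
proof -
  have "finite (snd ` {(j, k). jpd (U j k) F \<noteq> 0})" using finite_jpd_U by blast
  then obtain K where "\<forall>k\<in>snd ` {(j, k). jpd (U j k) F \<noteq> 0}. k < K"
    by (auto simp: finite_nat_set_iff_bounded)
  then show ?thesis unfolding jorder_def by (intro exI[of _ K]) force
qed

lemma jorder_ex_finite:
  assumes "finite I"
  shows "\<exists>K. \<forall>i\<in>I. jorder K (F i)"
proof -
  obtain K where K: "\<And>i. jorder (K i) (F i)"
    using choice[of "\<lambda>i K. jorder K (F i)"] jorder_ex by blast
  have "jorder (Max (K ` I)) (F i)" if "i \<in> I" for i
    using jorder_mono[OF K] that assms by auto
  then show ?thesis by blast
qed

lemma jorder_jpd: "jorder K F \<Longrightarrow> jorder K (jpd c F)"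
  by (simp add: jorder_def jpd_commute[of "U _ _" c])

lemma jorder_add: "jorder K F \<Longrightarrow> jorder K G \<Longrightarrow> jorder K (F + G)"
  by (simp add: jorder_def jpd_add)

lemma jorder_mult: "jorder K F \<Longrightarrow> jorder K G \<Longrightarrow> jorder K (F * G)"
  by (simp add: jorder_def jpd_mult)

section \<open>The total derivative as a derivation\<close>

lemma Dx_expand:
  fixes F :: "'m::finite jfun"
  assumes "jorder K F"
  shows "Dx F = jpd X F + (\<Sum>j\<in>UNIV. \<Sum>k<K. coord_fun (U j (Suc k)) * jpd (U j k) F)"
  unfolding Dx_def by (subst Sum_any_pair[where K = K]) (auto simp: jorderD[OF assms])

lemma Dx_add: "Dx (F + G) = Dx F + Dx (G :: 'm::finite jfun)"
proof -
  obtain K where "jorder K F" "jorder K G"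
    using jorder_ex_finite[of "{F, G}" "\<lambda>F. F"] by auto
  then show ?thesis
    by (simp add: Dx_expand[of K] jorder_add jpd_add algebra_simps sum.distrib)
qed

lemma Dx_mult: "Dx (F * G) = Dx F * G + F * Dx (G :: 'm::finite jfun)"
proof -
  obtain K where "jorder K F" "jorder K G"
    using jorder_ex_finite[of "{F, G}" "\<lambda>F. F"] by auto
  then show ?thesis
    by (simp add: Dx_expand[of K] jorder_mult jpd_mult algebra_simps sum.distrib sum_distrib_left
        sum_distrib_right)
qed

lemma Dx_scaleR: "Dx (r *\<^sub>R F) = r *\<^sub>R Dx (F :: 'm::finite jfun)"
proof -
  have "Dx (r *\<^sub>R (1 :: 'm jfun)) = 0"
    unfolding Dx_def jpd_const by simp
  then show ?thesis using Dx_mult[of "r *\<^sub>R 1" F] by simp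
qed

lemma Dx_pow_add: "(Dx ^^ k) (F + G) = (Dx ^^ k) F + (Dx ^^ k) (G :: 'm::finite jfun)"
  by (induction k) (simp_all add: Dx_add)

lemma Dx_pow_scaleR: "(Dx ^^ k) (r *\<^sub>R F) = r *\<^sub>R (Dx ^^ k) (F :: 'm::finite jfun)"
  by (induction k) (simp_all add: Dx_scaleR)

lemma Dx_pow_minus: "(Dx ^^ k) (- F) = - (Dx ^^ k) (F :: 'm::finite jfun)"
  using Dx_pow_scaleR[of k "-1" F] by simp

lemma Dx_pow_sum: "(Dx ^^ k) (sum F I) = (\<Sum>i\<in>I. (Dx ^^ k) (F i :: 'm::finite jfun))"
  by (induction I rule: infinite_finite_induct) (simp_all add: Dx_pow_add)

text \<open>Partial derivatives commute, so the commutator with \<open>Dx\<close> only comes from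
  differentiating the coefficients \<open>coord_fun (U i (Suc n))\<close>; the one with
  \<open>Suc n = k\<close> survives.\<close>

lemma jpd_Dx:
  "jpd (U j k) (Dx F) = Dx (jpd (U j k) F) + (if k = 0 then 0 else jpd (U j (k - 1)) (F :: 'm::finite jfun))"
proof -
  obtain K where K: "jorder K F" using jorder_ex by blast
  \<comment> \<open>The larger bound ensures that the index \<open>k - 1\<close> lies in the range
    of summation.\<close>
  have K': "jorder (max K k) F" using K jorder_mono by fastforce
  have "jpd (U j k) (Dx F) = Dx (jpd (U j k) F) +
    (\<Sum>i\<in>UNIV. \<Sum>n<max K k. (if U j k = U i (Suc n) then 1 else 0) * jpd (U i n) F)"
    by (simp add: Dx_expand[OF K'] Dx_expand[OF jorder_jpd[OF K']] jpd_add jpd_sum jpd_mult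
        jpd_coord_fun sum.distrib jpd_commute[of "U j k"] add.assoc)
  also have "(\<Sum>i\<in>UNIV. \<Sum>n<max K k. (if U j k = U i (Suc n) then 1 else 0) * jpd (U i n) F) =
    (\<Sum>i\<in>UNIV. if i = j then \<Sum>n<max K k. if k = Suc n then jpd (U j n) F else 0 else 0)"
    by (intro sum.cong refl) (auto intro!: sum.cong)
  also have "\<dots> = (if k = 0 then 0 else jpd (U j (k - 1)) F)"
    by (cases k) auto
  finally show ?thesis .
qed

lemma Dx_sum: "Dx (sum F I) = (\<Sum>i\<in>I. Dx (F i :: 'm::finite jfun))"
  using Dx_pow_sum[of 1] by simp

text \<open>As real scalars, the signs written as ring factors in the definitions pass through every
  linear map.\<close>

lemma minus_one_power_mult: "(-1) ^ k * F = (-1) ^ k *\<^sub>R (F :: 'a::real_algebra_1)"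
  by (cases "even k") auto

text \<open>\<open>elstar j a \<omega>\<close> is the component \<open>j\<close> of \<open>\<ell>\<^sup>*\<^sub>a(\<omega>)\<close>.\<close>

definition elstar :: "'m \<Rightarrow> 'm jfun \<Rightarrow> 'm jfun \<Rightarrow> 'm jfun" where
  "elstar j a \<omega> = Sum_any (\<lambda>k. (-1) ^ k *\<^sub>R (Dx ^^ k) (jpd (U j k) a * \<omega>))"

lemma elstar_expand:
  assumes "jorder K a"
  shows "elstar j a \<omega> = (\<Sum>k<K. (-1) ^ k *\<^sub>R (Dx ^^ k) (jpd (U j k) a * \<omega>))"
  unfolding elstar_def
proof (rule Sum_any.expand_superset)
  have "(-1) ^ k *\<^sub>R (Dx ^^ k) (jpd (U j k) a * \<omega>) = 0" if "K \<le> k" for k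
    by (simp add: jorderD[OF assms that])
  then show "{k. (-1) ^ k *\<^sub>R (Dx ^^ k) (jpd (U j k) a * \<omega>) \<noteq> 0} \<subseteq> {..<K}"
    by (metis (mono_tags, lifting) lessThan_iff mem_Collect_eq not_le subsetI)
qed simp

lemma elstar_add_left: "elstar j (a + b) \<omega> = elstar j a \<omega> + elstar j b (\<omega> :: 'm::finite jfun)"
proof -
  obtain K where "jorder K a" "jorder K b"
    using jorder_ex_finite[of "{a, b}" "\<lambda>F. F"] by auto
  then show ?thesis
    by (simp add: elstar_expand[of K] jorder_add jpd_add distrib_right Dx_pow_add scaleR_add_right sum.distrib)
qed

lemma elstar_scaleR_left: "elstar j (r *\<^sub>R a) \<omega> = r *\<^sub>R elstar j a (\<omega> :: 'm::finite jfun)"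
proof -
  obtain K where "jorder K a" "jorder K (r *\<^sub>R a)"
    using jorder_ex_finite[of "{a, r *\<^sub>R a}" "\<lambda>F. F"] by auto
  then show ?thesis
    by (simp add: elstar_expand[of K] jpd_scaleR Dx_pow_scaleR scaleR_sum_right mult.commute)
qed

lemma elstar_0_left: "elstar j 0 \<omega> = 0"
  by (simp add: elstar_def)

lemma elstar_sum_left: "elstar j (sum a I) \<omega> = (\<Sum>i\<in>I. elstar j (a i) (\<omega> :: 'm::finite jfun))"
  by (induction I rule: infinite_finite_induct) (simp_all add: elstar_add_left elstar_0_left)

lemma elstar_minus_left: "elstar j (- a) \<omega> = - elstar j a (\<omega> :: 'm::finite jfun)"
  using elstar_scaleR_left[of j "-1" a \<omega>] by simp

lemma elstar_add_right: "elstar j a (\<omega> + \<eta>) = elstar j a \<omega> + elstar j a (\<eta> :: 'm::finite jfun)"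
proof -
  obtain K where "jorder K a" using jorder_ex by blast
  then show ?thesis
    by (simp add: elstar_expand[of K] distrib_left Dx_pow_add scaleR_add_right sum.distrib)
qed

lemma elstar_scaleR_right: "elstar j a (r *\<^sub>R \<omega>) = r *\<^sub>R elstar j a (\<omega> :: 'm::finite jfun)"
proof -
  obtain K where "jorder K a" using jorder_ex by blast
  then show ?thesis
    by (simp add: elstar_expand[of K] Dx_pow_scaleR scaleR_sum_right mult.commute)
qed

lemma elstar_0_right: "elstar j a 0 = 0"
  by (simp add: elstar_def)

lemma elstar_sum_right: "elstar j a (sum \<omega> I) = (\<Sum>i\<in>I. elstar j a (\<omega> i :: 'm::finite jfun))"
  by (induction I rule: infinite_finite_induct) (simp_all add: elstar_add_right elstar_0_right)

text \<open>The formula \<open>\<ell>\<^bsub>D a\<^esub> = D \<circ> \<ell>\<^sub>a\<close>, in adjoint form.\<close>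

lemma elstar_Dx: "elstar j (Dx a) \<omega> = - elstar j a (Dx (\<omega> :: 'm::finite jfun))"
proof -
  obtain K where K: "jorder K a" using jorder_ex by blast
  have DK: "jorder (Suc K) (Dx a)"
    using K by (auto simp: jorder_def jpd_Dx Suc_le_eq)
  let ?d = "\<lambda>k. jpd (U j k) a"
  have "elstar j (Dx a) \<omega> = (\<Sum>k<Suc K. (-1) ^ k *\<^sub>R (Dx ^^ k) (Dx (?d k) * \<omega>)) +
    (\<Sum>k<Suc K. (-1) ^ k *\<^sub>R (Dx ^^ k) ((if k = 0 then 0 else ?d (k - 1)) * \<omega>))"
    by (simp only: elstar_expand[OF DK] jpd_Dx distrib_right Dx_pow_add scaleR_add_right sum.distrib)
  also have "(\<Sum>k<Suc K. (-1) ^ k *\<^sub>R (Dx ^^ k) (Dx (?d k) * \<omega>)) =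
    (\<Sum>k<K. (-1) ^ k *\<^sub>R (Dx ^^ k) (Dx (?d k) * \<omega>))"
    by (simp add: jorderD[OF K])
  \<comment> \<open>The term for \<open>k = 0\<close> vanishes; shifting the index costs one sign
    and leaves one additional \<open>Dx\<close>.\<close>
  also have "(\<Sum>k<Suc K. (-1) ^ k *\<^sub>R (Dx ^^ k) ((if k = 0 then 0 else ?d (k - 1)) * \<omega>)) =
    - (\<Sum>k<K. (-1) ^ k *\<^sub>R (Dx ^^ k) (Dx (?d k * \<omega>)))"
    by (subst sum.lessThan_Suc_shift) (simp add: sum_negf funpow_swap1 del: funpow.simps add: funpow_Suc_right)
  \<comment> \<open>By the product rule, the two sums differ exactly by the terms in which
    \<open>Dx\<close> falls on \<open>\<omega>\<close>.\<close>
  also have "(\<Sum>k<K. (-1) ^ k *\<^sub>R (Dx ^^ k) (Dx (?d k) * \<omega>)) +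
      - (\<Sum>k<K. (-1) ^ k *\<^sub>R (Dx ^^ k) (Dx (?d k * \<omega>))) = - elstar j a (Dx \<omega>)"
    by (simp add: elstar_expand[OF K] Dx_mult Dx_pow_add scaleR_add_right sum.distrib)
  finally show ?thesis .
qed

lemma elstar_Dx_pow: "elstar j ((Dx ^^ n) a) \<omega> = (-1) ^ n *\<^sub>R elstar j a ((Dx ^^ n) (\<omega> :: 'm::finite jfun))"
proof (induction n arbitrary: \<omega>)
  case (Suc n)
  then show ?case by (simp add: elstar_Dx) (simp add: funpow_swap1)
qed simp

section \<open>Leibniz formulas for powers of the total derivative\<close>

lemma sum_binomial_Suc:
  fixes g :: "nat \<Rightarrow> 'a::real_vector"
  shows "(\<Sum>i\<le>Suc m. real (Suc m choose i) *\<^sub>R g i) =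
    (\<Sum>i\<le>m. real (m choose i) *\<^sub>R g i) + (\<Sum>i\<le>m. real (m choose i) *\<^sub>R g (Suc i))"
proof -
  \<comment> \<open>The additional term has the coefficient \<open>m choose Suc m\<close>, which is
    zero.\<close>
  have "(\<Sum>i\<le>m. real (m choose i) *\<^sub>R g i) = (\<Sum>i\<le>Suc m. real (m choose i) *\<^sub>R g i)"
    by simp
  also have "\<dots> = g 0 + (\<Sum>i\<le>m. real (m choose Suc i) *\<^sub>R g (Suc i))"
    by (subst sum.atMost_Suc_shift) simp
  finally show ?thesis
    by (subst sum.atMost_Suc_shift) (simp add: scaleR_left_distrib sum.distrib)
qed

lemma Dx_pow_mult:
  fixes F G :: "'m::finite jfun"
  shows "(Dx ^^ m) (F * G) = (\<Sum>i\<le>m. real (m choose i) *\<^sub>R ((Dx ^^ (m - i)) F * (Dx ^^ i) G))"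
proof (induction m)
  case (Suc m)
  have e: "Dx ((Dx ^^ (m - i)) F) = (Dx ^^ (Suc m - i)) F" if "i \<le> m" for i
    using that by (simp add: Suc_diff_le)
  have "(Dx ^^ Suc m) (F * G) =
    (\<Sum>i\<le>m. real (m choose i) *\<^sub>R (Dx ((Dx ^^ (m - i)) F) * (Dx ^^ i) G)) +
    (\<Sum>i\<le>m. real (m choose i) *\<^sub>R ((Dx ^^ (m - i)) F * Dx ((Dx ^^ i) G)))"
    by (simp add: Dx_sum Suc Dx_scaleR Dx_mult scaleR_add_right sum.distrib)
  then show ?case
    unfolding sum_binomial_Suc by (simp add: e)
qed simp

text \<open>The inverse Leibniz formula. The induction step is
  \<open>F * Dx H = Dx (F * H) - Dx F * H\<close> with \<open>H = (Dx ^^ m) G\<close>; the induction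
  hypothesis is used for both \<open>F\<close> and \<open>Dx F\<close>.\<close>

lemma mult_Dx_pow:
  fixes F G :: "'m::finite jfun"
  shows "(\<Sum>i\<le>m. ((-1) ^ i * real (m choose i)) *\<^sub>R (Dx ^^ (m - i)) ((Dx ^^ i) F * G)) = F * (Dx ^^ m) G"
proof (induction m arbitrary: F)
  case (Suc m)
  have e: "(Dx ^^ (Suc m - i)) H = Dx ((Dx ^^ (m - i)) H)" if "i \<le> m" for i and H :: "'m jfun"
    using that by (simp add: Suc_diff_le)
  let ?g = "\<lambda>i. (-1) ^ i *\<^sub>R (Dx ^^ (Suc m - i)) ((Dx ^^ i) F * G)"
  have "(\<Sum>i\<le>Suc m. ((-1) ^ i * real (Suc m choose i)) *\<^sub>R (Dx ^^ (Suc m - i)) ((Dx ^^ i) F * G)) =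
    (\<Sum>i\<le>Suc m. real (Suc m choose i) *\<^sub>R ?g i)"
    by (simp add: mult.commute)
  also have "\<dots> = (\<Sum>i\<le>m. real (m choose i) *\<^sub>R ?g i) + (\<Sum>i\<le>m. real (m choose i) *\<^sub>R ?g (Suc i))"
    by (rule sum_binomial_Suc)
  also have "(\<Sum>i\<le>m. real (m choose i) *\<^sub>R ?g i) =
    Dx (\<Sum>i\<le>m. ((-1) ^ i * real (m choose i)) *\<^sub>R (Dx ^^ (m - i)) ((Dx ^^ i) F * G))"
    by (simp add: Dx_sum e Dx_scaleR mult.commute)
  also have "(\<Sum>i\<le>m. real (m choose i) *\<^sub>R ?g (Suc i)) =
    - (\<Sum>i\<le>m. ((-1) ^ i * real (m choose i)) *\<^sub>R (Dx ^^ (m - i)) ((Dx ^^ i) (Dx F) * G))"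
    by (simp add: sum_negf mult.commute funpow_swap1)
  finally show ?case by (simp add: Suc Dx_mult)
qed simp

section \<open>Coefficients of the adjoint operator\<close>

definition op_order :: "nat \<Rightarrow> 'm operator \<Rightarrow> bool" where
  "op_order N A \<longleftrightarrow> (\<forall>l i j. N \<le> i \<longrightarrow> A l i j = 0)"

lemma op_orderD: "op_order N A \<Longrightarrow> N \<le> i \<Longrightarrow> A l i j = 0"
  by (simp add: op_order_def)

lemma op_order_ex:
  assumes "cdiff_operator A"
  shows "\<exists>N. op_order N A"
proof -
  have "finite ((fst \<circ> snd) ` {(l, i, j). A l i j \<noteq> 0})"
    using assms unfolding cdiff_operator_def by blast
  then obtain N where "\<forall>i\<in>(fst \<circ> snd) ` {(l, i, j). A l i j \<noteq> 0}. i < N"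
    by (auto simp: finite_nat_set_iff_bounded)
  then show ?thesis unfolding op_order_def by (intro exI[of _ N]) force
qed

lemma op_app_expand:
  fixes A :: "'m::finite operator"
  assumes "op_order N A"
  shows "op_app A \<psi> l = (\<Sum>j\<in>UNIV. \<Sum>i<N. A l i j * (Dx ^^ i) (\<psi> j))"
  unfolding op_app_def by (subst Sum_any_pair(2)[where K = N]) (auto simp: op_orderD[OF assms])

lemma adj_app_expand:
  fixes A :: "'m::finite operator"
  assumes "op_order N A"
  shows "adj_app A \<psi> j = (\<Sum>l\<in>UNIV. \<Sum>i<N. (-1) ^ i *\<^sub>R (Dx ^^ i) (A l i j * \<psi> l))"
  unfolding adj_app_def
  by (subst Sum_any_pair(2)[where K = N]) (auto simp: op_orderD[OF assms] minus_one_power_mult)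

text \<open>At \<open>z\<close>, the test vector with the Taylor monomial of degree \<open>i\<close>
  about \<open>z X\<close> in the slot \<open>j\<close> has only one nonzero derivative, the one
  multiplied by the coefficient sought.\<close>

lemma op_app_inject:
  fixes A B :: "'m::finite operator"
  assumes A: "op_order N A" and B: "op_order N B" and eq: "op_app A = op_app B"
  shows "A = B"
proof (intro ext)
  fix l i j
  show "A l i j = B l i j"
  proof (cases "i < N")
    case True
    define \<tau> where "\<tau> = (\<lambda>(z :: 'm point) j'. if j' = j then taylor (z X) i else (0 :: 'm jfun))"
    have jt: "jval ((Dx ^^ i') (\<tau> z j')) z = (if j' = j then if i' = i then 1 else 0 else 0)" for z i' j'
      by (auto simp: \<tau>_def Dx_pow_taylor jval_taylor zero_jfun.rep_eq)
    have "jval (op_app C (\<tau> z) l) z = jval (C l i j) z" if "op_order N C" for C z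
      using True
      by (simp add: op_app_expand[OF that] jval_sum times_jfun.rep_eq jt if_distrib[of "\<lambda>x. _ * x"]
          sum.If_cases cong: if_cong)
    then have "jval (A l i j) z = jval (B l i j) z" for z using A B eq by metis
    then show ?thesis by (simp add: jval_inject[symmetric] fun_eq_iff)
  qed (simp add: op_orderD[OF A] op_orderD[OF B])
qed

lemma op_jorder_ex:
  fixes A :: "'m::finite operator"
  assumes N: "op_order N A"
  shows "\<exists>K. \<forall>l i j. jorder K (A l i j)"
proof -
  obtain K where "\<forall>x\<in>UNIV \<times> {..<N} \<times> UNIV. jorder K (A (fst x) (fst (snd x)) (snd (snd x)))"
    using jorder_ex_finite[of "UNIV \<times> {..<N} \<times> UNIV" "\<lambda>x. A (fst x) (fst (snd x)) (snd (snd x))"] by auto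
  then have "jorder K (A l i j)" for l i j
    using op_orderD[OF N] by (cases "i < N") (auto simp: jorder_def)
  then show ?thesis by blast
qed

text \<open>These arise when the Leibniz formula is applied to the powers of \<open>Dx\<close> in
  front of the products in \<open>adj_app\<close>; the matrix is transposed. For
  \<open>m < i\<close> the truncated \<open>m - i\<close> is harmless, since the binomial
  coefficient is zero.\<close>

definition adj_coeffs :: "nat \<Rightarrow> 'm operator \<Rightarrow> 'm operator" where
  "adj_coeffs N A l i j = (\<Sum>m<N. ((-1) ^ m * real (m choose i)) *\<^sub>R (Dx ^^ (m - i)) (A j m l))"

lemma op_order_adj_coeffs: "op_order N (adj_coeffs N A)"
  by (auto simp: op_order_def adj_coeffs_def intro!: sum.neutral)

lemma sum_binomial_truncate:
  fixes g :: "nat \<Rightarrow> 'a::real_vector"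
  assumes "m < N"
  shows "(\<Sum>i<N. real (m choose i) *\<^sub>R g i) = (\<Sum>i\<le>m. real (m choose i) *\<^sub>R g i)"
  using assms by (intro sum.mono_neutral_right) auto

lemma op_app_adj_coeffs:
  fixes A :: "'m::finite operator"
  assumes "op_order N A"
  shows "op_app (adj_coeffs N A) \<psi> = adj_app A \<psi>"
proof
  fix l
  have "op_app (adj_coeffs N A) \<psi> l = (\<Sum>j\<in>UNIV. \<Sum>i<N. \<Sum>m<N.
      (-1) ^ m *\<^sub>R real (m choose i) *\<^sub>R ((Dx ^^ (m - i)) (A j m l) * (Dx ^^ i) (\<psi> j)))"
    by (simp add: op_app_expand[OF op_order_adj_coeffs] adj_coeffs_def sum_distrib_right)
  also have "\<dots> = (\<Sum>j\<in>UNIV. \<Sum>m<N. (-1) ^ m *\<^sub>R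
      (\<Sum>i<N. real (m choose i) *\<^sub>R ((Dx ^^ (m - i)) (A j m l) * (Dx ^^ i) (\<psi> j))))"
    by (subst sum.swap[of _ "{..<N}"]) (simp only: scaleR_sum_right)
  also have "\<dots> = adj_app A \<psi> l"
    unfolding adj_app_expand[OF assms] Dx_pow_mult by (simp add: sum_binomial_truncate)
  finally show "op_app (adj_coeffs N A) \<psi> l = adj_app A \<psi> l" .
qed

text \<open>Skew-adjointness is a statement about the action on vectors. Uniqueness of coefficients
  turns it into an identity of functions, to which the linearization can be applied.\<close>

lemma skew_adjoint_coeffs:
  fixes A :: "'m::finite operator"
  assumes N: "op_order N A" and skew: "skew_adjoint A"
  shows "A l i j = - adj_coeffs N A l i j"
proof -
  have "op_order N (\<lambda>l i j. - adj_coeffs N A l i j)" (is "op_order N ?B")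
    using op_order_adj_coeffs by (simp add: op_order_def)
  moreover from this have "op_app ?B \<psi> l = - op_app (adj_coeffs N A) \<psi> l" for \<psi> l
    by (simp add: op_app_expand[of N] op_order_adj_coeffs sum_negf)
  then have "op_app A = op_app ?B"
    using skew by (intro ext) (simp add: op_app_adj_coeffs[OF N] skew_adjoint_def)
  ultimately have "A = ?B" using N op_app_inject by blast
  then show ?thesis by meson
qed

section \<open>Skew-symmetry of the adjoint linearization\<close>

lemma ell_adj_expand:
  fixes A :: "'m::finite operator"
  assumes N: "op_order N A"
  shows "ell_adj A \<psi>1 \<psi>2 j =
    (\<Sum>l\<in>UNIV. \<Sum>s\<in>UNIV. \<Sum>i<N. elstar j (A l i s) ((Dx ^^ i) (\<psi>1 s) * \<psi>2 l))"
proof -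
  obtain K where K: "\<And>l i j. jorder K (A l i j)" using op_jorder_ex[OF N] by blast
  have lin: "op_lin A \<psi>1 l k j = (\<Sum>s\<in>UNIV. \<Sum>i<N. jpd (U j k) (A l i s) * (Dx ^^ i) (\<psi>1 s))" for l k
    unfolding op_lin_def by (subst Sum_any_pair(2)[where K = N]) (auto simp: op_orderD[OF N])
  have "op_order K (op_lin A \<psi>1)"
    by (auto simp: op_order_def op_lin_def jorderD[OF K])
  then have "ell_adj A \<psi>1 \<psi>2 j = (\<Sum>l\<in>UNIV. \<Sum>k<K. \<Sum>s\<in>UNIV. \<Sum>i<N.
      (-1) ^ k *\<^sub>R (Dx ^^ k) (jpd (U j k) (A l i s) * ((Dx ^^ i) (\<psi>1 s) * \<psi>2 l)))"
    unfolding ell_adj_def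
    by (simp only: adj_app_expand lin sum_distrib_right Dx_pow_sum scaleR_sum_right mult.assoc)
  also have "\<dots> = (\<Sum>l\<in>UNIV. \<Sum>s\<in>UNIV. \<Sum>i<N. elstar j (A l i s) ((Dx ^^ i) (\<psi>1 s) * \<psi>2 l))"
    by (simp only: sum.swap[of _ "{..<K}"] elstar_expand[OF K])
  finally show ?thesis .
qed

text \<open>Each coefficient is replaced by minus that of the adjoint. By
  \<open>elstar_Dx_pow\<close> the derivatives of the coefficients move to the second argument of
  \<open>elstar\<close>, and there the inverse Leibniz formula sums them to
  \<open>\<psi>1 s * (Dx ^^ m) (\<psi>2 l)\<close>.\<close>

lemma ell_adj_skew:
  fixes A :: "'m::finite operator"
  assumes "cdiff_operator A" and skew: "skew_adjoint A"
  shows "ell_adj A \<psi>1 \<psi>2 j = - ell_adj A \<psi>2 \<psi>1 j"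
proof -
  obtain N where N: "op_order N A" using op_order_ex assms(1) by blast
  \<comment> \<open>One sign comes from the adjoint, the other from moving \<open>m - i\<close>
    derivatives; together they give the sign of \<open>mult_Dx_pow\<close>.\<close>
  have sgn: "((-1) ^ m * r) * (-1) ^ (m - i) = (-1) ^ i * (r :: real)" if "i \<le> m" for m i r
    using that by (simp add: minus_one_power_iff)
  \<comment> \<open>The entry \<open>(l, s)\<close> is matched with the entry \<open>(s, l)\<close>;
    the final summation over both indices absorbs the transposition.\<close>
  have *: "(\<Sum>i<N. elstar j (A l i s) ((Dx ^^ i) (\<psi>1 s) * \<psi>2 l)) =
    - (\<Sum>m<N. elstar j (A s m l) ((Dx ^^ m) (\<psi>2 l) * \<psi>1 s))" for l s
  proof -
    have "(\<Sum>i<N. elstar j (A l i s) ((Dx ^^ i) (\<psi>1 s) * \<psi>2 l)) =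
      - (\<Sum>i<N. \<Sum>m<N. real (m choose i) *\<^sub>R ((-1) ^ m *\<^sub>R (-1) ^ (m - i) *\<^sub>R
          elstar j (A s m l) ((Dx ^^ (m - i)) ((Dx ^^ i) (\<psi>1 s) * \<psi>2 l))))"
      by (subst skew_adjoint_coeffs[OF N skew])
        (simp add: adj_coeffs_def elstar_minus_left elstar_sum_left elstar_scaleR_left elstar_Dx_pow sum_negf mult_ac)
    also have "\<dots> = - (\<Sum>m<N. \<Sum>i\<le>m. real (m choose i) *\<^sub>R ((-1) ^ m *\<^sub>R (-1) ^ (m - i) *\<^sub>R
          elstar j (A s m l) ((Dx ^^ (m - i)) ((Dx ^^ i) (\<psi>1 s) * \<psi>2 l))))"
      by (subst sum.swap) (rule arg_cong[where f = uminus], rule sum.cong[OF refl], rule sum_binomial_truncate, simp)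
    also have "\<dots> = - (\<Sum>m<N. elstar j (A s m l)
        (\<Sum>i\<le>m. ((-1) ^ i * real (m choose i)) *\<^sub>R (Dx ^^ (m - i)) ((Dx ^^ i) (\<psi>1 s) * \<psi>2 l)))"
      using sgn[where r = 1]
      by (simp add: elstar_sum_right elstar_scaleR_right mult.commute)
    finally show ?thesis unfolding mult_Dx_pow by (simp add: mult.commute)
  qed
  have "ell_adj A \<psi>1 \<psi>2 j = (\<Sum>l\<in>UNIV. \<Sum>s\<in>UNIV. - (\<Sum>m<N. elstar j (A s m l) ((Dx ^^ m) (\<psi>2 l) * \<psi>1 s)))"
    unfolding ell_adj_expand[OF N] * ..
  also have "\<dots> = - ell_adj A \<psi>2 \<psi>1 j"
    unfolding ell_adj_expand[OF N] by (subst sum.swap) (simp add: sum_negf)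
  finally show ?thesis .
qed

section \<open>The exterior algebra\<close>

lemma sfun_eqI: "(\<And>S. scoeff F S = scoeff G S) \<Longrightarrow> F = G"
  by (simp add: scoeff_inject[symmetric] fun_eq_iff)

lemma finite_scoeff: "finite {S. scoeff F S \<noteq> 0}"
  using scoeff[of F] by simp

lemma scoeff_infinite: "infinite S \<Longrightarrow> scoeff F S = 0"
  using scoeff[of F] by blast

lemmas scoeff_simps = zero_sfun.rep_eq plus_sfun.rep_eq scaleR_sfun.rep_eq emb.rep_eq

lemma scoeff_sum: "scoeff (sum F I) S = (\<Sum>i\<in>I. scoeff (F i) S)"
  by (induction I rule: infinite_finite_induct) (simp_all add: scoeff_simps)

lemma smult_raw_emb:
  assumes "finite S"
  shows "smult_raw (\<lambda>V. if V = {} then a else 0) c S = a * c S"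
    and "smult_raw c (\<lambda>V. if V = {} then a else 0) S = a * c S"
proof -
  have "smult_raw (\<lambda>V. if V = {} then a else 0) c S = (\<Sum>V\<in>Pow S. if V = {} then a * c S else 0)"
    unfolding smult_raw_def by (intro sum.cong) auto
  then show "smult_raw (\<lambda>V. if V = {} then a else 0) c S = a * c S"
    using assms by simp
  have "smult_raw c (\<lambda>V. if V = {} then a else 0) S = (\<Sum>V\<in>Pow S. if V = S then a * c S else 0)"
    unfolding smult_raw_def by (intro sum.cong) (auto simp: mult.commute)
  then show "smult_raw c (\<lambda>V. if V = {} then a else 0) S = a * c S"
    using assms by simp
qed

lemma scoeff_emb_mult: "scoeff (emb a * F) S = a * scoeff F S"
  and scoeff_mult_emb: "scoeff (F * emb a) S = a * scoeff F S"
  by (cases "finite S"; simp add: times_sfun.rep_eq emb.rep_eq smult_raw_emb smult_raw_infinite scoeff_infinite)+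

lemma emb_commute: "F * emb a = emb a * F"
  by (rule sfun_eqI) (simp add: scoeff_emb_mult scoeff_mult_emb)

lemma emb_left_commute: "F * (emb a * G) = emb a * (F * G)"
  by (simp add: mult.assoc[symmetric] emb_commute)

lemma emb_0 [simp]: "emb 0 = 0"
  by (rule sfun_eqI) (simp add: scoeff_simps)

lemma emb_1: "emb 1 = 1"
  by (rule sfun_eqI) (simp add: scoeff_simps one_sfun.rep_eq)

lemma emb_add: "emb (a + b) = emb a + emb b"
  by (rule sfun_eqI) (simp add: scoeff_simps)

lemma emb_scaleR: "emb (r *\<^sub>R a) = r *\<^sub>R emb a"
  by (rule sfun_eqI) (simp add: scoeff_simps)

lemma emb_mult: "emb (a * b) = emb a * emb b"
  by (rule sfun_eqI) (simp add: scoeff_emb_mult emb.rep_eq)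

section \<open>Generators and left derivatives, indexed by pairs as in the monomials\<close>

definition pvar :: "'m gen \<Rightarrow> 'm sfun" where
  "pvar g = odd_var (fst g) (snd g)"

definition opd :: "'m::countable gen \<Rightarrow> 'm sfun \<Rightarrow> 'm sfun" where
  "opd g = odd_pd (fst g) (snd g)"

lemma scoeff_opd: "scoeff (opd g F) S = (if g \<in> S then 0 else (-1) ^ invs {g} S * scoeff F (insert g S))"
  by (simp add: opd_def odd_pd.rep_eq)

lemma scoeff_pvar_mult:
  "scoeff (pvar g * F) S = (if g \<in> S then (-1) ^ invs {g} (S - {g}) * scoeff F (S - {g}) else 0)"
  by (cases "finite S")
    (auto simp: pvar_def times_sfun.rep_eq odd_var.rep_eq smult_raw_single scoeff_infinite smult_raw_infinite)

lemma opd_pvar_mult: "opd g (pvar h * F) = (if g = h then F else 0) - pvar h * opd g F"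
  by (simp add: opd_def pvar_def odd_pd_odd_var_mult prod_eq_iff)

lemma pvar_anticommute: "pvar g * pvar h = - (pvar h * pvar g)"
  unfolding pvar_def by (rule odd_var_anticommute)

lemma opd_add: "opd g (F + G) = opd g F + opd g G"
  by (rule sfun_eqI) (simp add: scoeff_opd scoeff_simps algebra_simps)

lemma opd_emb [simp]: "opd g (emb a) = 0"
  by (rule sfun_eqI) (simp add: scoeff_opd scoeff_simps)

lemma opd_emb_mult: "opd g (emb a * F) = emb a * opd g F"
  by (rule sfun_eqI) (simp add: scoeff_opd scoeff_emb_mult)

lemma opd_0 [simp]: "opd g 0 = 0"
  using opd_emb[of g 0] by simp

text \<open>A generator with nonzero derivative occurs in one of the finitely many monomials of
  \<open>F\<close>, each of which is finite.\<close>

lemma finite_opd: "finite {g. opd g F \<noteq> 0}"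
proof -
  have "{g. opd g F \<noteq> 0} \<subseteq> \<Union>{S. scoeff F S \<noteq> 0}"
  proof
    fix g assume "g \<in> {g. opd g F \<noteq> 0}"
    then obtain S where "scoeff (opd g F) S \<noteq> 0"
      using sfun_eqI[of "opd g F" 0] by (auto simp: scoeff_simps)
    then have "scoeff F (insert g S) \<noteq> 0" by (auto simp: scoeff_opd split: if_splits)
    then show "g \<in> \<Union>{S. scoeff F S \<noteq> 0}" by blast
  qed
  moreover have "finite (\<Union>{S. scoeff F S \<noteq> 0})"
    using finite_scoeff scoeff_infinite by (intro finite_Union) blast+
  ultimately show ?thesis by (rule finite_subset)
qed

lift_definition srestrict :: "'m gen set set \<Rightarrow> 'm sfun \<Rightarrow> 'm sfun" is "\<lambda>A c S. if S \<in> A then c S else 0"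
  by (auto elim: rev_finite_subset)

text \<open>An element is a finite sum of monomials, and a monomial is built from its coefficient by
  multiplying with generators from the left. Identities between additive maps thus reduce to their
  product rules.\<close>

lemma sfun_induct [case_names emb pvar_mult add]:
  fixes F :: "'m::countable sfun"
  assumes emb: "\<And>a. P (emb a)" and pvar: "\<And>g F. P F \<Longrightarrow> P (pvar g * F)"
    and add: "\<And>F G. P F \<Longrightarrow> P G \<Longrightarrow> P (F + G)"
  shows "P F"
proof -
  have mono: "P F" if "finite S" "\<And>V. V \<noteq> S \<Longrightarrow> scoeff F V = 0" for S F
    using that
  proof (induction S arbitrary: F rule: finite_induct)
    case empty
    then have "F = emb (scoeff F {})" by (intro sfun_eqI) (simp add: scoeff_simps)
    then show ?case using emb by metis
  next
    case (insert g S)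
    have "scoeff (opd g F) V = 0" if "V \<noteq> S" for V
    proof (cases "g \<in> V")
      case False
      then have "insert g V \<noteq> insert g S" using that insert.hyps by (simp add: insert_ident)
      then show ?thesis using insert.prems by (simp add: scoeff_opd)
    qed (simp add: scoeff_opd)
    then have "P (pvar g * opd g F)" by (intro pvar insert.IH)
    \<comment> \<open>The only monomial of \<open>F\<close> contains \<open>g\<close>, so taking
      \<open>g\<close> out at the front and putting it back restores \<open>F\<close>.\<close>
    moreover have "pvar g * opd g F = F"
    proof (rule sfun_eqI)
      fix V
      show "scoeff (pvar g * opd g F) V = scoeff F V"
      proof (cases "g \<in> V")
        case True
        then show ?thesis
          by (simp add: scoeff_pvar_mult scoeff_opd insert_absorb mult.assoc[symmetric] power_mult_distrib[symmetric])
      next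
        case False
        then have "V \<noteq> insert g S" by auto
        then show ?thesis using False insert.prems by (simp add: scoeff_pvar_mult)
      qed
    qed
    ultimately show ?case by simp
  qed
  \<comment> \<open>Induction on the support, splitting off one monomial at a time.\<close>
  have "P F" if "finite A" "A \<subseteq> Collect finite" "\<And>V. V \<notin> A \<Longrightarrow> scoeff F V = 0" for A F
    using that
  proof (induction A arbitrary: F rule: finite_induct)
    case empty
    then have "F = emb 0" by (intro sfun_eqI) (simp add: scoeff_simps)
    then show ?case using emb by metis
  next
    case (insert S A)
    have "P (srestrict {S} F)"
      using insert.prems by (intro mono[of S]) (auto simp: srestrict.rep_eq)
    moreover have "P (srestrict A F)"
      using insert.prems by (intro insert.IH) (auto simp: srestrict.rep_eq)
    moreover have "F = srestrict {S} F + srestrict A F"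
      using insert.prems insert.hyps by (intro sfun_eqI) (auto simp: srestrict.rep_eq scoeff_simps)
    ultimately show ?case using add by metis
  qed
  then show ?thesis
    using finite_scoeff[of F] scoeff_infinite by blast
qed

text \<open>The case distinction in \<open>coeffwise\<close> keeps supports finite for arbitrary
  maps; it disappears for maps that send zero to zero.\<close>

lemma scoeff_coeffwise: "linear d \<Longrightarrow> scoeff (coeffwise d F) S = d (scoeff F S)"
  by (simp add: coeffwise.rep_eq linear_0)

lemma coeffwise_add: "linear d \<Longrightarrow> coeffwise d (F + G) = coeffwise d F + coeffwise d G"
  by (rule sfun_eqI) (simp add: scoeff_coeffwise scoeff_simps linear_add)

lemma coeffwise_emb: "linear d \<Longrightarrow> coeffwise d (emb a) = emb (d a)"
  by (rule sfun_eqI) (simp add: scoeff_coeffwise scoeff_simps linear_0)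

lemma coeffwise_pvar_mult:
  assumes "linear d"
  shows "coeffwise d (pvar g * F) = pvar g * coeffwise d F"
  using assms
  by (intro sfun_eqI)
    (simp add: scoeff_coeffwise scoeff_pvar_mult linear_0 linear_scale minus_one_power_mult)

lemma coeffwise_emb_mult:
  assumes "linear d" "\<And>b. d (a * b) = d a * b + a * d b"
  shows "coeffwise d (emb a * F) = emb (d a) * F + emb a * coeffwise d F"
  using assms by (intro sfun_eqI) (simp add: scoeff_coeffwise scoeff_emb_mult scoeff_simps)

lemma linear_jpd: "linear (jpd c)"
  by (rule linearI) (simp_all add: jpd_add jpd_scaleR)

lemma linear_Dx: "linear (Dx :: 'm::finite jfun \<Rightarrow> 'm jfun)"
  by (rule linearI) (simp_all add: Dx_add Dx_scaleR)

lemmas spd_add = coeffwise_add[OF linear_jpd]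
  and spd_emb = coeffwise_emb[OF linear_jpd]
  and spd_pvar_mult = coeffwise_pvar_mult[OF linear_jpd]

lemma spd_0 [simp]: "spd c 0 = 0"
  using spd_emb[of c 0] by simp

lemma spd_sum: "spd c (sum F I) = (\<Sum>i\<in>I. spd c (F i))"
  by (induction I rule: infinite_finite_induct) (simp_all add: spd_add)

lemma spd_emb_mult: "spd c (emb a * F) = emb (jpd c a) * F + emb a * spd c F"
  by (rule coeffwise_emb_mult) (simp_all add: linear_jpd jpd_mult)

text \<open>A common form of the odd part of \<open>sDx\<close>, of the Euler operator and of
  contraction; \<open>w\<close> prescribes the images of the generators.\<close>

definition opd_sum :: "('m gen \<Rightarrow> 'm sfun) \<Rightarrow> 'm::countable sfun \<Rightarrow> 'm sfun" where
  "opd_sum w F = Sum_any (\<lambda>g. w g * opd g F)"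

lemma opd_sum_expand:
  assumes "finite G" "{g. opd g F \<noteq> 0} \<subseteq> G"
  shows "opd_sum w F = (\<Sum>g\<in>G. w g * opd g F)"
  unfolding opd_sum_def using assms by (intro Sum_any.expand_superset) auto

lemma opd_sum_add: "opd_sum w (F + G) = opd_sum w F + opd_sum w G"
proof -
  let ?S = "{g. opd g F \<noteq> 0} \<union> {g. opd g G \<noteq> 0}"
  have "finite ?S" using finite_opd by blast
  moreover have "{g. opd g (F + G) \<noteq> 0} \<subseteq> ?S" by (auto simp: opd_add)
  ultimately show ?thesis
    by (simp add: opd_sum_expand[of ?S] opd_add distrib_left sum.distrib)
qed

lemma opd_sum_emb [simp]: "opd_sum w (emb a) = 0"
  by (simp add: opd_sum_def)

lemma opd_sum_emb_mult: "opd_sum w (emb a * F) = emb a * opd_sum w F"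
proof -
  let ?S = "{g. opd g F \<noteq> 0}"
  have "{g. opd g (emb a * F) \<noteq> 0} \<subseteq> ?S" by (auto simp: opd_emb_mult)
  then show ?thesis
    by (simp add: opd_sum_expand[of ?S] finite_opd opd_emb_mult sum_distrib_left emb_left_commute)
qed

text \<open>The scalar \<open>r\<close> records how the images pass a generator: \<open>-1\<close>
  for odd images gives the ordinary product rule, \<open>1\<close> for even images the graded
  one.\<close>

lemma opd_sum_pvar_mult:
  assumes "\<And>g. w g * pvar h = r *\<^sub>R (pvar h * w g)"
  shows "opd_sum w (pvar h * F) = w h * F - r *\<^sub>R (pvar h * opd_sum w F)"
proof -
  \<comment> \<open>The product may depend on \<open>h\<close> even if \<open>F\<close> does
    not.\<close>
  let ?S = "insert h {g. opd g F \<noteq> 0}"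
  have *: "w g * (pvar h * opd g F) = r *\<^sub>R (pvar h * (w g * opd g F))" for g
    using assms by (simp add: mult.assoc[symmetric])
  have "{g. opd g (pvar h * F) \<noteq> 0} \<subseteq> ?S" by (auto simp: opd_pvar_mult)
  then have "opd_sum w (pvar h * F) = (\<Sum>g\<in>?S. w g * (if g = h then F else 0)) - (\<Sum>g\<in>?S. w g * (pvar h * opd g F))"
    by (simp only: opd_sum_expand[of ?S] finite_insert finite_opd opd_pvar_mult right_diff_distrib sum_subtractf)
  also have "(\<Sum>g\<in>?S. w g * (if g = h then F else 0)) = (\<Sum>g\<in>?S. if g = h then w h * F else 0)"
    by (intro sum.cong) auto
  also have "\<dots> = w h * F" using finite_opd[of F] by (subst sum.delta) auto
  also have "(\<Sum>g\<in>?S. w g * (pvar h * opd g F)) = r *\<^sub>R (pvar h * opd_sum w F)"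
    by (simp only: * opd_sum_expand[of ?S, OF _ subset_insertI] finite_insert finite_opd scaleR_sum_right sum_distrib_left)
  finally show ?thesis .
qed

section \<open>The total derivative on the covering\<close>

lemma sDx_alt: "sDx F = coeffwise Dx F + opd_sum (\<lambda>g. pvar (fst g, Suc (snd g))) F"
  by (simp add: sDx_def opd_sum_def pvar_def opd_def case_prod_beta')

lemma sDx_add: "sDx (F + G) = sDx F + sDx (G :: 'm::finite sfun)"
  by (simp add: sDx_alt coeffwise_add linear_Dx opd_sum_add)

lemma sDx_emb: "sDx (emb a) = emb (Dx (a :: 'm::finite jfun))"
  by (simp add: sDx_alt coeffwise_emb linear_Dx)

lemma sDx_0 [simp]: "sDx (0 :: 'm::finite sfun) = 0"
  using sDx_emb[of 0] by simp

lemma sDx_pvar_mult: "sDx (pvar g * F) = pvar (fst g, Suc (snd g)) * F + pvar g * sDx (F :: 'm::finite sfun)"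
proof -
  have "opd_sum (\<lambda>g. pvar (fst g, Suc (snd g))) (pvar g * F) =
    pvar (fst g, Suc (snd g)) * F - (-1) *\<^sub>R (pvar g * opd_sum (\<lambda>g. pvar (fst g, Suc (snd g))) F)"
    by (rule opd_sum_pvar_mult) (simp add: pvar_anticommute[of _ g])
  then show ?thesis
    by (simp add: sDx_alt coeffwise_pvar_mult linear_Dx algebra_simps)
qed

text \<open>Homogeneous elements of degree \<open>n\<close> in the odd variables. The inductive form
  lets degrees be computed by rule induction from the product rules alone.\<close>

inductive odd_degree :: "nat \<Rightarrow> 'm::countable sfun \<Rightarrow> bool" where
  emb: "odd_degree 0 (emb a)"
| pvar_mult: "odd_degree n F \<Longrightarrow> odd_degree (Suc n) (pvar g * F)"
| add: "odd_degree n F \<Longrightarrow> odd_degree n G \<Longrightarrow> odd_degree n (F + G)"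

lemma odd_degree_zero: "odd_degree n 0"
proof (induction n)
  case 0
  then show ?case using odd_degree.emb[of 0] by simp
next
  case (Suc n)
  then show ?case using odd_degree.pvar_mult[of n 0] by simp
qed

lemma odd_degree_sum: "(\<And>i. i \<in> I \<Longrightarrow> odd_degree n (F i)) \<Longrightarrow> odd_degree n (sum F I)"
  by (induction I rule: infinite_finite_induct) (auto simp: odd_degree_zero odd_degree.add)

lemma odd_degree_emb_mult: "odd_degree n F \<Longrightarrow> odd_degree n (emb a * F)"
  by (induction rule: odd_degree.induct)
    (auto simp: emb_mult[symmetric] emb_left_commute[symmetric] distrib_left intro: odd_degree.intros)

lemma odd_degree_scaleR: "odd_degree n F \<Longrightarrow> odd_degree n (r *\<^sub>R F)"
  using odd_degree_emb_mult[of n F "r *\<^sub>R 1"] by (simp add: emb_scaleR emb_1)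

lemma odd_degree_diff: "odd_degree n F \<Longrightarrow> odd_degree n G \<Longrightarrow> odd_degree n (F - G)"
  using odd_degree.add[of n F "-1 *\<^sub>R G"] odd_degree_scaleR[of n G "-1"] by simp

lemma odd_degree_pvar: "odd_degree (Suc 0) (pvar g)"
  using odd_degree.pvar_mult[OF odd_degree.emb[of 1], of g] by (simp add: emb_1)

lemma odd_degree_mult: "odd_degree m F \<Longrightarrow> odd_degree n G \<Longrightarrow> odd_degree (m + n) (F * G)"
  by (induction rule: odd_degree.induct)
    (auto simp: distrib_right mult.assoc odd_degree_emb_mult intro: odd_degree.intros)

lemma odd_degree_spd: "odd_degree n F \<Longrightarrow> odd_degree n (spd c F)"
  by (induction rule: odd_degree.induct) (auto simp: spd_emb spd_pvar_mult spd_add intro: odd_degree.intros)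

lemma odd_degree_sDx: "odd_degree n F \<Longrightarrow> odd_degree n (sDx (F :: 'm::finite sfun))"
  by (induction rule: odd_degree.induct) (auto simp: sDx_emb sDx_pvar_mult sDx_add intro: odd_degree.intros)

lemma odd_degree_sDx_pow: "odd_degree n F \<Longrightarrow> odd_degree n ((sDx ^^ k) (F :: 'm::finite sfun))"
  by (induction k) (auto simp: odd_degree_sDx)

lemma odd_degree_0D: "odd_degree 0 F \<Longrightarrow> F = emb (scoeff F {})"
  by (induction "0 :: nat" F rule: odd_degree.induct) (simp_all add: scoeff_simps emb_add)

text \<open>In degree zero the derivative vanishes, and zero has every degree, which justifies the
  truncated \<open>n - 1\<close>. The case \<open>n = 0\<close> in the proof is special because the
  factor \<open>pvar h\<close> would otherwise raise the degree to one.\<close>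

lemma odd_degree_opd: "odd_degree n F \<Longrightarrow> odd_degree (n - 1) (opd g F)"
proof (induction rule: odd_degree.induct)
  case (pvar_mult n F h)
  have "odd_degree n (pvar h * opd g F)"
  proof (cases n)
    case 0
    then show ?thesis
      using odd_degree_0D pvar_mult.hyps opd_emb by (metis mult_zero_right odd_degree_zero)
  next
    case (Suc m)
    then show ?thesis using pvar_mult.IH odd_degree.pvar_mult[of m] by simp
  qed
  then show ?case
    using pvar_mult.hyps by (simp add: opd_pvar_mult odd_degree_diff odd_degree_zero)
qed (auto simp: opd_add odd_degree_zero intro: odd_degree.add)

text \<open>Euler's identity in the odd variables: the operator is an even derivation that fixes
  every generator, so each factor contributes one.\<close>

lemma opd_sum_pvar:
  assumes "odd_degree n F"
  shows "opd_sum pvar F = real n *\<^sub>R F"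
  using assms
proof (induction rule: odd_degree.induct)
  case (pvar_mult n F h)
  have "opd_sum pvar (pvar h * F) = pvar h * F - (-1) *\<^sub>R (pvar h * opd_sum pvar F)"
    by (rule opd_sum_pvar_mult) (simp add: pvar_anticommute[of _ h])
  then show ?case by (simp add: pvar_mult.IH scaleR_left_distrib)
qed (simp_all add: opd_sum_add scaleR_add_right)

section \<open>Contraction with a vector of functions\<close>

definition contract :: "('m \<Rightarrow> 'm jfun) \<Rightarrow> 'm sfun \<Rightarrow> 'm::countable sfun" where
  "contract \<psi> = opd_sum (\<lambda>g. emb ((Dx ^^ snd g) (\<psi> (fst g))))"

lemma contract_add: "contract \<psi> (F + G) = contract \<psi> F + contract \<psi> G"
  by (simp add: contract_def opd_sum_add)

lemma contract_emb [simp]: "contract \<psi> (emb a) = 0"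
  by (simp add: contract_def)

lemma contract_0 [simp]: "contract \<psi> 0 = 0"
  using contract_emb[of \<psi> 0] by simp

lemma contract_sum: "contract \<psi> (sum F I) = (\<Sum>i\<in>I. contract \<psi> (F i))"
  by (induction I rule: infinite_finite_induct) (simp_all add: contract_add)

lemma contract_emb_mult: "contract \<psi> (emb a * F) = emb a * contract \<psi> F"
  by (simp add: contract_def opd_sum_emb_mult)

lemma contract_scaleR: "contract \<psi> (r *\<^sub>R F) = r *\<^sub>R contract \<psi> F"
  using contract_emb_mult[of \<psi> "r *\<^sub>R 1" F] by (simp add: emb_scaleR emb_1)

lemma contract_pvar_mult:
  "contract \<psi> (pvar g * F) = emb ((Dx ^^ snd g) (\<psi> (fst g))) * F - pvar g * contract \<psi> F"
  using opd_sum_pvar_mult[of "\<lambda>g. emb ((Dx ^^ snd g) (\<psi> (fst g)))" g 1 F]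
  by (simp add: contract_def emb_commute)

lemma contract_pvar: "contract \<psi> (pvar g) = emb ((Dx ^^ snd g) (\<psi> (fst g)))"
  using contract_pvar_mult[of \<psi> g 1] contract_emb[of \<psi> 1] by (simp add: emb_1)

lemma sDx_emb_mult: "sDx (emb a * F) = emb (Dx a) * F + emb a * sDx (F :: 'm::finite sfun)"
  by (simp add: sDx_alt coeffwise_emb_mult linear_Dx Dx_mult opd_sum_emb_mult distrib_left add.assoc)

lemma sDx_scaleR: "sDx (r *\<^sub>R F) = r *\<^sub>R sDx (F :: 'm::finite sfun)"
  using sDx_emb_mult[of "r *\<^sub>R 1" F] Dx_scaleR[of r "1 :: 'm jfun"] Dx_mult[of "1 :: 'm jfun" 1]
  by (simp add: emb_scaleR emb_1)

lemma sDx_minus: "sDx (- F) = - sDx (F :: 'm::finite sfun)"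
  using sDx_scaleR[of "-1" F] by simp

lemma sDx_diff: "sDx (F - G) = sDx F - sDx (G :: 'm::finite sfun)"
  by (simp only: diff_conv_add_uminus sDx_add sDx_minus)

text \<open>On a generator, raising the index and then contracting gives one more \<open>Dx\<close>
  on the component of \<open>\<psi>\<close>, which is what \<open>sDx\<close> does after
  contraction. The product rules extend this to all elements.\<close>

lemma contract_sDx: "contract \<psi> (sDx F) = sDx (contract \<psi> (F :: 'm::finite sfun))"
proof (induction F rule: sfun_induct)
  case (pvar_mult g F)
  then show ?case
    by (simp add: sDx_pvar_mult contract_add contract_pvar_mult sDx_diff sDx_emb_mult)
qed (simp_all add: sDx_emb sDx_add contract_add)

lemma contract_mult:
  assumes "odd_degree n F"
  shows "contract \<psi> (F * G) = contract \<psi> F * G + (-1) ^ n *\<^sub>R (F * contract \<psi> G)"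
  using assms
proof (induction rule: odd_degree.induct)
  case (pvar_mult n F h)
  then show ?case
    by (simp add: contract_pvar_mult mult.assoc algebra_simps)
qed (simp_all add: contract_emb_mult contract_add distrib_right scaleR_add_right)

lemma contract_odd_degree:
  assumes "odd_degree n F"
  shows "odd_degree (n - 1) (contract \<psi> F)"
  unfolding contract_def opd_sum_expand[OF finite_opd subset_refl]
  by (intro odd_degree_sum odd_degree_emb_mult odd_degree_opd assms)

section \<open>Contraction of the Jacobi bracket\<close>

lemma scoeff_sDx_empty: "scoeff (sDx F) {} = Dx (scoeff (F :: 'm::finite sfun) {})"
proof -
  have "scoeff (opd_sum (\<lambda>g. pvar (fst g, Suc (snd g))) F) {} = 0"
    by (simp add: opd_sum_expand[OF finite_opd subset_refl] scoeff_sum scoeff_pvar_mult)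
  then show ?thesis
    by (simp add: sDx_alt scoeff_simps scoeff_coeffwise linear_Dx)
qed

text \<open>Taking the generator-free coefficient returns to differential functions; nothing is lost
  on elements of degree one.\<close>

definition lin_app :: "('m \<Rightarrow> 'm jfun) \<Rightarrow> 'm::countable sfun \<Rightarrow> 'm jfun" where
  "lin_app \<psi> F = scoeff (contract \<psi> F) {}"

definition quad_app :: "('m \<Rightarrow> 'm jfun) \<Rightarrow> ('m \<Rightarrow> 'm jfun) \<Rightarrow> 'm::countable sfun \<Rightarrow> 'm jfun" where
  "quad_app \<psi>1 \<psi>2 F = lin_app \<psi>2 (contract \<psi>1 F)"

lemma contract_lin: "odd_degree (Suc 0) F \<Longrightarrow> contract \<psi> F = emb (lin_app \<psi> F)"
  using odd_degree_0D[of "contract \<psi> F"] contract_odd_degree[of "Suc 0" F \<psi>] by (simp add: lin_app_def)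

lemma lin_app_add: "lin_app \<psi> (F + G) = lin_app \<psi> F + lin_app \<psi> G"
  by (simp add: lin_app_def contract_add scoeff_simps)

lemma lin_app_sum: "lin_app \<psi> (sum F I) = (\<Sum>i\<in>I. lin_app \<psi> (F i))"
  by (simp add: lin_app_def contract_sum scoeff_sum)

lemma lin_app_emb_mult: "lin_app \<psi> (emb a * F) = a * lin_app \<psi> F"
  by (simp add: lin_app_def contract_emb_mult scoeff_emb_mult)

lemma lin_app_scaleR: "lin_app \<psi> (r *\<^sub>R F) = r *\<^sub>R lin_app \<psi> F"
  by (simp add: lin_app_def contract_scaleR scoeff_simps)

lemma lin_app_sDx_pow: "lin_app \<psi> ((sDx ^^ k) F) = (Dx ^^ k) (lin_app \<psi> (F :: 'm::finite sfun))"
  by (induction k) (simp_all add: lin_app_def contract_sDx scoeff_sDx_empty)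

lemma lin_app_pvar: "lin_app \<psi> (pvar g) = (Dx ^^ snd g) (\<psi> (fst g))"
  by (simp add: lin_app_def contract_pvar scoeff_simps)

lemma contract_sDx_pow: "contract \<psi> ((sDx ^^ k) F) = (sDx ^^ k) (contract \<psi> (F :: 'm::finite sfun))"
  by (induction k) (simp_all add: contract_sDx)

lemma quad_app_add: "quad_app \<psi>1 \<psi>2 (F + G) = quad_app \<psi>1 \<psi>2 F + quad_app \<psi>1 \<psi>2 G"
  by (simp add: quad_app_def contract_add lin_app_add)

lemma quad_app_sum: "quad_app \<psi>1 \<psi>2 (sum F I) = (\<Sum>i\<in>I. quad_app \<psi>1 \<psi>2 (F i))"
  by (simp add: quad_app_def contract_sum lin_app_sum)

lemma quad_app_scaleR: "quad_app \<psi>1 \<psi>2 (r *\<^sub>R F) = r *\<^sub>R quad_app \<psi>1 \<psi>2 F"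
  by (simp add: quad_app_def contract_scaleR lin_app_scaleR)

lemma quad_app_mult_emb: "quad_app \<psi>1 \<psi>2 (F * emb a) = a * quad_app \<psi>1 \<psi>2 F"
  by (simp add: emb_commute quad_app_def contract_emb_mult lin_app_emb_mult)

lemma quad_app_sDx_pow:
  "quad_app \<psi>1 \<psi>2 ((sDx ^^ k) F) = (Dx ^^ k) (quad_app \<psi>1 \<psi>2 (F :: 'm::finite sfun))"
  by (simp add: quad_app_def contract_sDx_pow lin_app_sDx_pow)

text \<open>The minus sign arises when the contraction passes the odd factor \<open>F\<close>. For
  two generators, the result is the skew-symmetric operator attached to their product.\<close>

lemma quad_app_mult:
  assumes "odd_degree (Suc 0) F" "odd_degree (Suc 0) G"
  shows "quad_app \<psi>1 \<psi>2 (F * G) = lin_app \<psi>1 F * lin_app \<psi>2 G - lin_app \<psi>2 F * lin_app \<psi>1 G"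
proof -
  have "contract \<psi>1 (F * G) = emb (lin_app \<psi>1 F) * G + (-1) *\<^sub>R (emb (lin_app \<psi>1 G) * F)"
    using contract_mult[OF assms(1), of \<psi>1 G] by (simp add: contract_lin assms emb_commute)
  then show ?thesis
    unfolding quad_app_def by (simp only: lin_app_add lin_app_emb_mult lin_app_scaleR) (simp add: mult.commute)
qed

section \<open>The elements \<open>ham A\<close> and their derivatives\<close>

lemma op_order_op_lin:
  assumes "\<And>l i j. jorder K (A l i j)"
  shows "op_order K (op_lin A \<psi>)"
  by (auto simp: op_order_def op_lin_def jorderD[OF assms])

lemma ham_expand:
  assumes "op_order N A"
  shows "ham A l = (\<Sum>j\<in>UNIV. \<Sum>i<N. emb (A l i j) * pvar (j, i))"
  unfolding ham_def pvar_def
  by (subst Sum_any_pair(2)[where K = N]) (auto simp: op_orderD[OF assms])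

lemma odd_degree_ham: "op_order N A \<Longrightarrow> odd_degree (Suc 0) (ham A l)"
  by (auto simp: ham_expand intro!: odd_degree_sum odd_degree_emb_mult odd_degree_pvar)

lemma lin_app_ham: "op_order N A \<Longrightarrow> lin_app \<psi> (ham A l) = op_app A \<psi> l"
  by (simp add: ham_expand op_app_expand lin_app_sum lin_app_emb_mult lin_app_pvar)

lemma spd_pvar [simp]: "spd c (pvar g) = 0"
  using spd_pvar_mult[of c g 1] spd_emb[of c 1] jpd_const[of c 1] by (simp add: emb_1)

lemma spd_ham:
  assumes "op_order N A"
  shows "spd c (ham A l) = (\<Sum>j\<in>UNIV. \<Sum>i<N. emb (jpd c (A l i j)) * pvar (j, i))"
  by (simp add: ham_expand[OF assms] spd_sum spd_emb_mult)

lemma spd_ham_eq_0: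
  assumes "op_order N A" "\<And>l i j. jorder K (A l i j)" "K \<le> k"
  shows "spd (U j k) (ham A l) = 0"
  by (simp add: spd_ham[OF assms(1)] jorderD[OF assms(2,3)])

lemma lin_app_spd_ham:
  assumes "op_order N A"
  shows "lin_app \<psi> (spd (U s k) (ham A l)) = op_lin A \<psi> l k s"
proof -
  have "op_lin A \<psi> l k s = (\<Sum>j\<in>UNIV. \<Sum>i<N. jpd (U s k) (A l i j) * (Dx ^^ i) (\<psi> j))"
    unfolding op_lin_def by (subst Sum_any_pair(2)[where K = N]) (auto simp: op_orderD[OF assms])
  then show ?thesis
    by (simp add: spd_ham[OF assms] lin_app_sum lin_app_emb_mult lin_app_pvar)
qed

lemma opd_of_sum: "opd g (sum F I) = (\<Sum>i\<in>I. opd g (F i))"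
  by (induction I rule: infinite_finite_induct) (simp_all add: opd_add)

lemma opd_pvar: "opd g (pvar h) = (if g = h then 1 else 0)"
  using opd_pvar_mult[of g h 1] opd_emb[of g 1] by (simp add: emb_1)

lemma opd_ham:
  assumes "op_order N A"
  shows "opd (j, k) (ham A l) = emb (A l k j)"
proof -
  have "opd (j, k) (ham A l) = (\<Sum>j'\<in>UNIV. \<Sum>i<N. if j = j' then if k = i then emb (A l i j') else 0 else 0)"
    unfolding ham_expand[OF assms] opd_of_sum opd_emb_mult opd_pvar
    by (intro sum.cong refl) auto
  also have "\<dots> = (\<Sum>j'\<in>UNIV. if j = j' then \<Sum>i<N. if k = i then emb (A l i j') else 0 else 0)"
    by (intro sum.cong refl) simp
  \<comment> \<open>For \<open>k \<ge> N\<close> the inner sum has no matching index, and the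
    coefficient is zero as well.\<close>
  also have "\<dots> = emb (A l k j)"
    using op_orderD[OF assms] by (cases "k < N") (auto simp: sum.delta')
  finally show ?thesis .
qed

lemma sDx_pow_0 [simp]: "(sDx ^^ k) (0 :: 'm::finite sfun) = 0"
  by (induction k) simp_all

section \<open>The odd components of the derivation\<close>

lemma sell_adj_p_ham:
  assumes A: "op_order N A" "\<And>l i j. jorder K (A l i j)"
  shows "sell_adj_p (ham A) j =
    (\<Sum>l\<in>UNIV. \<Sum>k<K. (-1) ^ k *\<^sub>R (sDx ^^ k) (spd (U j k) (ham A l) * pvar (l, 0)))"
  unfolding sell_adj_p_def
  by (subst Sum_any_pair(2)[where K = K]) (auto simp: spd_ham_eq_0[OF A] minus_one_power_mult pvar_def)

lemma odd_degree_sell_adj_p_ham: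
  assumes "op_order N A"
  shows "odd_degree (Suc (Suc 0)) (sell_adj_p (ham A) j)"
proof -
  obtain K where K: "\<And>l i j. jorder K (A l i j)" using op_jorder_ex[OF assms] by blast
  have "odd_degree (Suc (Suc 0)) (spd (U j k) (ham A l) * pvar (l, 0))" for k l
    using odd_degree_mult[OF odd_degree_spd[OF odd_degree_ham[OF assms]] odd_degree_pvar] by simp
  then show ?thesis
    unfolding sell_adj_p_ham[OF assms K]
    by (intro odd_degree_sum odd_degree_scaleR odd_degree_sDx_pow)
qed

text \<open>Contraction antisymmetrizes \<open>ell_adj\<close> in the two vectors. By
  \<open>ell_adj_skew\<close> both terms are equal; the resulting factor 2 cancels the
  \<open>1/2\<close> in \<open>odd_field\<close>.\<close>

lemma quad_app_sell_adj_p_ham: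
  assumes "cdiff_operator A" "skew_adjoint A" "op_order N A"
  shows "quad_app \<psi>1 \<psi>2 (sell_adj_p (ham A) j) = 2 *\<^sub>R ell_adj A \<psi>1 \<psi>2 j"
proof -
  obtain K where K: "\<And>l i j. jorder K (A l i j)" using op_jorder_ex[OF assms(3)] by blast
  note lin = op_order_op_lin[of K A, OF K]
  have "quad_app \<psi>1 \<psi>2 (sell_adj_p (ham A) j) = (\<Sum>l\<in>UNIV. \<Sum>k<K. (-1) ^ k *\<^sub>R
      (Dx ^^ k) (op_lin A \<psi>1 l k j * \<psi>2 l - op_lin A \<psi>2 l k j * \<psi>1 l))"
    unfolding sell_adj_p_ham[OF assms(3) K]
    by (simp add: quad_app_sum quad_app_scaleR quad_app_sDx_pow quad_app_mult odd_degree_spd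
        odd_degree_ham[OF assms(3)] odd_degree_pvar lin_app_spd_ham[OF assms(3)] lin_app_pvar)
  also have "\<dots> = ell_adj A \<psi>1 \<psi>2 j - ell_adj A \<psi>2 \<psi>1 j"
    unfolding ell_adj_def adj_app_expand[OF lin]
    by (simp only: diff_conv_add_uminus Dx_pow_add Dx_pow_minus scaleR_add_right scaleR_minus_right
        sum.distrib sum_negf)
  finally show ?thesis
    using ell_adj_skew[OF assms(1,2), of \<psi>2 \<psi>1 j] by (simp add: scaleR_2)
qed

section \<open>The two halves of the bracket\<close>

lemma odd_field_ham:
  assumes B: "op_order N B" "\<And>l i j. jorder K (B l i j)"
  shows "odd_field H (ham B l) =
    (\<Sum>j\<in>UNIV. \<Sum>k<K. (sDx ^^ k) (H j) * spd (U j k) (ham B l)) +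
    (\<Sum>j\<in>UNIV. \<Sum>k<N. (sDx ^^ k) (- ((1/2) *\<^sub>R sell_adj_p H j)) * emb (B l k j))"
proof -
  have opd: "odd_pd j k (ham B l) = emb (B l k j)" for j k
    using opd_ham[OF B(1)] by (simp add: opd_def)
  \<comment> \<open>Two bounds enter: \<open>K\<close> for the order of the coefficients in the
    \<open>u\<close>-part, \<open>N\<close> for the order of the operator in the
    \<open>p\<close>-part.\<close>
  show ?thesis
    unfolding odd_field_def opd
    by (subst Sum_any_pair(1)[where K = K], simp add: spd_ham_eq_0[OF B])
      (subst Sum_any_pair(1)[where K = N], simp_all add: op_orderD[OF B(1)])
qed

lemma odd_degree_odd_field_ham:
  assumes "op_order M A" "op_order N B"
  shows "odd_degree 2 (odd_field (ham A) (ham B l))"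
proof -
  obtain K where K: "\<And>l i j. jorder K (B l i j)" using op_jorder_ex[OF assms(2)] by blast
  have "odd_degree (Suc 0 + Suc 0) ((sDx ^^ k) (ham A j) * spd (U j k) (ham B l))" for j k
    by (intro odd_degree_mult odd_degree_sDx_pow odd_degree_spd odd_degree_ham[OF assms(1)]
        odd_degree_ham[OF assms(2)])
  moreover have "odd_degree (Suc (Suc 0)) ((sDx ^^ k) (- ((1/2) *\<^sub>R sell_adj_p (ham A) j)) * emb (B l k j))" for j k
    unfolding emb_commute scaleR_minus_left[symmetric]
    by (intro odd_degree_emb_mult odd_degree_sDx_pow odd_degree_scaleR odd_degree_sell_adj_p_ham[OF assms(1)])
  ultimately show ?thesis
    unfolding odd_field_ham[OF assms(2) K] numeral_2_eq_2
    by (intro odd_degree.add odd_degree_sum) simp_all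
qed

text \<open>This is the half of the Schouten bracket in which \<open>B\<close> is linearized or acts
  last; exchanging \<open>A\<close> and \<open>B\<close> gives the other half.\<close>

lemma quad_app_odd_field_ham:
  assumes A: "cdiff_operator A" "skew_adjoint A" and B: "cdiff_operator B"
  shows "quad_app \<psi>1 \<psi>2 (odd_field (ham A) (ham B l)) =
    ell B \<psi>2 (op_app A \<psi>1) l - ell B \<psi>1 (op_app A \<psi>2) l - op_app B (ell_adj A \<psi>1 \<psi>2) l"
proof -
  obtain M N where M: "op_order M A" and N: "op_order N B"
    using op_order_ex A(1) B by blast
  obtain K where K: "\<And>l i j. jorder K (B l i j)" using op_jorder_ex[OF N] by blast
  note lin = op_order_op_lin[of K B, OF K]
  have "quad_app \<psi>1 \<psi>2 (- ((1/2) *\<^sub>R sell_adj_p (ham A) j)) = - ell_adj A \<psi>1 \<psi>2 j" for j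
    unfolding scaleR_minus_left[symmetric] quad_app_scaleR quad_app_sell_adj_p_ham[OF A M] by simp
  then have "quad_app \<psi>1 \<psi>2 (odd_field (ham A) (ham B l)) =
    (\<Sum>j\<in>UNIV. \<Sum>k<K. (Dx ^^ k) (op_app A \<psi>1 j) * op_lin B \<psi>2 l k j - (Dx ^^ k) (op_app A \<psi>2 j) * op_lin B \<psi>1 l k j) -
    (\<Sum>j\<in>UNIV. \<Sum>k<N. B l k j * (Dx ^^ k) (ell_adj A \<psi>1 \<psi>2 j))"
    by (simp only: odd_field_ham[OF N K] quad_app_add quad_app_sum quad_app_mult_emb quad_app_sDx_pow
        quad_app_mult odd_degree_sDx_pow odd_degree_spd odd_degree_ham[OF N] odd_degree_ham[OF M]
        lin_app_sDx_pow lin_app_ham[OF M] lin_app_spd_ham[OF N] Dx_pow_minus mult_minus_right sum_negf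
        diff_conv_add_uminus)
  then show ?thesis
    by (simp add: op_app_op_lin[OF B, symmetric] op_app_expand[OF lin] op_app_expand[OF N] sum_subtractf
        mult.commute)
qed

text \<open>The coefficients of the operator are the iterated odd derivatives of \<open>F\<close>.
  Euler's identity, in degree one and then in degree two, rebuilds \<open>2 *\<^sub>R F l\<close>
  from them, and \<open>ham2\<close> halves it.\<close>

lemma ham2_quad_app:
  fixes F :: "'m::finite \<Rightarrow> 'm sfun"
  assumes deg: "\<And>l. odd_degree 2 (F l)"
  shows "ham2 (\<lambda>\<psi>1 \<psi>2 l. quad_app \<psi>1 \<psi>2 (F l)) = F"
proof
  fix l
  \<comment> \<open>The derivative by \<open>g\<close> comes first because \<open>\<psi>1\<close> is
    contracted first. In degree two the iterated derivative is a function, so its generator-free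
    coefficient determines it.\<close>
  define c where "c = (\<lambda>l g h. scoeff (opd h (opd g (F l))) {})"
  have c: "opd h (opd g (F l)) = emb (c l g h)" for l g h
    unfolding c_def
    using odd_degree_opd[OF odd_degree_opd[OF deg]] by (intro odd_degree_0D) simp
  \<comment> \<open>Index sets common to all components are needed, since finiteness of the
    coefficient family also involves the index \<open>l\<close>.\<close>
  define G where "G = (\<Union>l. {g. opd g (F l) \<noteq> 0})"
  define H where "H = (\<Union>l. \<Union>g\<in>G. {h. opd h (opd g (F l)) \<noteq> 0})"
  have fin: "finite G" "finite H" by (auto simp: G_def H_def finite_opd)
  have G: "{g. opd g (F l) \<noteq> 0} \<subseteq> G" for l by (auto simp: G_def)
  have H: "{h. opd h (opd g (F l)) \<noteq> 0} \<subseteq> H" for l g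
  proof (cases "g \<in> G")
    case False
    then have "opd g (F l) = 0" using G by blast
    then show ?thesis by simp
  qed (auto simp: H_def)
  have c0: "g \<in> G \<and> h \<in> H" if "c l g h \<noteq> 0" for l g h
  proof -
    have "opd h (opd g (F l)) \<noteq> 0" using that by (auto simp: c_def scoeff_simps)
    then have "opd g (F l) \<noteq> 0" "h \<in> H" using H[of g l] by auto
    then show ?thesis using G by auto
  qed
  have c_out: "c l (fst a) (snd a) = 0" if "a \<notin> G \<times> H" for l a
    using c0[of l "fst a" "snd a"] that by (auto simp: mem_Times_iff)
  have "{(l, g, h). c l g h \<noteq> 0} \<subseteq> UNIV \<times> G \<times> H" using c0 by auto
  then have "bi_finite c" unfolding bi_finite_def using fin by (auto intro: finite_subset)
  have "bi_app c \<psi>1 \<psi>2 l = quad_app \<psi>1 \<psi>2 (F l)" for \<psi>1 \<psi>2 l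
  proof -
    have "bi_app c \<psi>1 \<psi>2 l = (\<Sum>(g, h)\<in>G \<times> H. c l g h * (Dx ^^ snd g) (\<psi>1 (fst g)) * (Dx ^^ snd h) (\<psi>2 (fst h)))"
      unfolding bi_app_def case_prod_beta' prod.collapse
      by (rule Sum_any.expand_superset) (use fin in simp, rule subsetI, rule ccontr, simp add: c_out)
    also have "\<dots> = (\<Sum>g\<in>G. (Dx ^^ snd g) (\<psi>1 (fst g)) * (\<Sum>h\<in>H. (Dx ^^ snd h) (\<psi>2 (fst h)) * c l g h))"
      by (simp add: sum.cartesian_product[symmetric] sum_distrib_left mult_ac)
    also have "\<dots> = (\<Sum>g\<in>G. (Dx ^^ snd g) (\<psi>1 (fst g)) * lin_app \<psi>2 (opd g (F l)))"
      unfolding lin_app_def contract_def opd_sum_expand[OF fin(2) H]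
      by (simp add: scoeff_sum scoeff_emb_mult c_def)
    also have "(\<Sum>g\<in>G. (Dx ^^ snd g) (\<psi>1 (fst g)) * lin_app \<psi>2 (opd g (F l))) = quad_app \<psi>1 \<psi>2 (F l)"
      unfolding quad_app_def contract_def[of \<psi>1] opd_sum_expand[OF fin(1) G]
      by (simp add: lin_app_sum lin_app_emb_mult)
    finally show ?thesis .
  qed
  then have app: "bi_app c = (\<lambda>\<psi>1 \<psi>2 l. quad_app \<psi>1 \<psi>2 (F l))" by (intro ext)
  \<comment> \<open>The definite description is resolved by the uniqueness lemma
    \<open>bi_app_inject\<close>.\<close>
  have bi: "bi_coeffs (\<lambda>\<psi>1 \<psi>2 l. quad_app \<psi>1 \<psi>2 (F l)) = c"
    unfolding bi_coeffs_def app[symmetric]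
    by (rule the_equality) (auto intro: \<open>bi_finite c\<close> dest: bi_app_inject[OF _ \<open>bi_finite c\<close>])
  have "ham2 (\<lambda>\<psi>1 \<psi>2 l. quad_app \<psi>1 \<psi>2 (F l)) l =
    (1/2) *\<^sub>R Sum_any (\<lambda>a. emb (c l (fst a) (snd a)) * pvar (fst a) * pvar (snd a))"
    unfolding ham2_def bi case_prod_beta' prod.collapse pvar_def ..
  also have "Sum_any (\<lambda>a. emb (c l (fst a) (snd a)) * pvar (fst a) * pvar (snd a)) =
    (\<Sum>(g, h)\<in>G \<times> H. emb (c l g h) * pvar g * pvar h)"
    unfolding case_prod_beta'
    by (rule Sum_any.expand_superset)
      (use fin in simp, rule subsetI, rule ccontr, simp add: c_out)
  also have "(\<Sum>(g, h)\<in>G \<times> H. emb (c l g h) * pvar g * pvar h) = (\<Sum>g\<in>G. pvar g * (\<Sum>h\<in>H. pvar h * emb (c l g h)))"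
    by (simp add: sum.cartesian_product[symmetric] sum_distrib_left emb_commute emb_left_commute mult.assoc)
  also have "\<dots> = (\<Sum>g\<in>G. pvar g * opd g (F l))"
  proof (rule sum.cong[OF refl])
    fix g
    have "odd_degree 1 (opd g (F l))" using odd_degree_opd[OF deg, of g l] by simp
    from opd_sum_pvar[OF this] have "(\<Sum>h\<in>H. pvar h * emb (c l g h)) = opd g (F l)"
      by (simp add: opd_sum_expand[OF fin(2) H] c)
    then show "pvar g * (\<Sum>h\<in>H. pvar h * emb (c l g h)) = pvar g * opd g (F l)" by simp
  qed
  also have "\<dots> = 2 *\<^sub>R F l"
    using opd_sum_pvar[OF deg] by (simp add: opd_sum_expand[OF fin(1) G])
  finally show "ham2 (\<lambda>\<psi>1 \<psi>2 l. quad_app \<psi>1 \<psi>2 (F l)) l = F l" by simp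
qed

theorem theorem6:
  fixes f :: "'m::finite \<Rightarrow> 'm jfun" and A B :: "'m operator"
  assumes "cdiff_operator A" and "cdiff_operator B"
    and "skew_adjoint A" and "skew_adjoint B"
    and "shadow f (ham A)" and "shadow f (ham B)"
  shows "jacobi (ham A) (ham B) = ham2 (schouten A B)"
proof -
  \<comment> \<open>Each of the two summands of the bracket contributes one half; the second is the
    first with \<open>A\<close> and \<open>B\<close> exchanged.\<close>
  have "schouten A B \<psi>1 \<psi>2 l = quad_app \<psi>1 \<psi>2 (jacobi (ham A) (ham B) l)" for \<psi>1 \<psi>2 l
    unfolding schouten_def jacobi_def quad_app_add
    by (simp add: quad_app_odd_field_ham assms)
  then have "schouten A B = (\<lambda>\<psi>1 \<psi>2 l. quad_app \<psi>1 \<psi>2 (jacobi (ham A) (ham B) l))"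
    by (intro ext)
  \<comment> \<open>Homogeneity of degree two is what allows the bracket to be recovered from its
    contractions.\<close>
  moreover have "odd_degree 2 (jacobi (ham A) (ham B) l)" for l
    unfolding jacobi_def using op_order_ex[OF assms(1)] op_order_ex[OF assms(2)]
    by (blast intro: odd_degree.add odd_degree_odd_field_ham)
  ultimately show ?thesis using ham2_quad_app by metis
qed

end
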